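(* Consider the G-Latent model with $n$ i.i.d. samples, and let $\mathbf D=\hat{\boldsymbol\Gamma}-\hat{\boldsymbol\Sigma}$, where $\hat{\boldsymbol\Gamma}$ satisfies the estimator assumption below. Assume $\log d\le p_0 n$. There exist constants $c_1,c_2,c_3>0$ (not depending on $n,d,K,m,\mathbf C^*,\boldsymbol\Gamma^*$) such that if \[ \Delta(\mathbf C^* )\ \ge\ c_1\|\boldsymbol\Gamma^*\|_\infty\Big(\sqrt{\tfrac{\log d}{nm}}+\sqrt{\tfrac{d}{nm^2}}+\tfrac{d}{nm}\Big)+c_2\,\sigma\sqrt{\tfrac{\log d}{n}},\qquad \sigma=\max_i C^*_{ii}+\|\boldsymbol\Gamma^*\|_\infty, \] then with probability at least $1-c_3/d$ the FORCE dual certificate exists at $G^*$, i.e. there is $y_T\ge 0$ such that $\mathbf Q_i(\mathbf D,y_T)\succeq 0$ for every $i\in[K]$ and $y'_{ab}(\mathbf D,y_T)\ge 0$ for all $a,b$ lying in different clusters of $G^*$.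
   Context: G-Latent model: $G^*=\{G^*_1,\dots,G^*_K\}$ is a partition of $[d]$ with $m:=\min_k|G^*_k|\ge 3$; $\mathbf A\in\{0,1\}^{d\times K}$ with $A_{jk}=\mathbb 1\{j\in G^*_k\}$; $\mathbf X=\mathbf A\mathbf Z+\mathbf E$ where $\mathbf Z\sim\mathcal N(0,\mathbf C^* )$ in $\mathbb R^K$ and $\mathbf E\sim\mathcal N(0,\boldsymbol\Gamma^* )$ in $\mathbb R^d$ are independent and $\boldsymbol\Gamma^*$ is diagonal with entries $\gamma^*_j$. We observe $n$ i.i.d. copies $\mathbf X^1,\dots,\mathbf X^n$ and set $\hat{\boldsymbol\Sigma}=\frac1n\sum_{l=1}^n\mathbf X^l\mathbf X^{lT}$. $\|\cdot\|_\infty$ is the matrix $\ell_\infty$ norm (for a diagonal matrix, its largest absolute diagonal entry). $\Delta(\mathbf C^* ):=\min_{j<k}\mathbb E(Z_j-Z_k)^2=\min_{j<k}(C^*_{jj}+C^*_{kk}-2C^*_{jk})>0$. Estimator assumption: $\hat{\boldsymbol\Gamma}$ is a diagonal estimator of $\boldsymbol\Gamma^*$ for which there are constants $p_0,p_1,p_2$ such that whenever $\log d\le p_0 n$, with probability at least $1-p_2/d^3$, $\|\hat{\boldsymbol\Gamma}-\boldsymbol\Gamma^*\|_\infty\le p_1\|\boldsymbol\Gamma^*\|_\infty\sqrt{\log d/n}$. Certificate quantities: for a symmetric $d\times d$ matrix $\mathbf D$, $y_T\in\mathbb R$ and each $i$, write $\mathbf D_i=\mathbf D_{G^*_i,G^*_i}$,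 $n_i=|G^*_i|$, and define $\mathbf y_{G^*_i}(\mathbf D,y_T)=\mathbf L_i^{-1}(-\mathbf D_i\mathbf 1-y_T\mathbf 1)$ with $\mathbf L_i=n_i\mathbf I+\mathbf 1\mathbf 1^T$; equivalently, for $a\in G^*_i$, $y_a=\frac{1}{2n_i^2}\mathbf 1^T\mathbf D_i\mathbf 1-\frac1{n_i}\sum_{b\in G^*_i}D_{ab}-\frac{y_T}{2n_i}$. Define the $n_i\times n_i$ matrix $\mathbf Q_i(\mathbf D,y_T)=\mathbf D_i+\mathbf y_{G^*_i}\mathbf 1^T+\mathbf 1\mathbf y_{G^*_i}^T+y_T\mathbf I$, and for $a,b$ in different clusters $y'_{ab}(\mathbf D,y_T)=D_{ab}+y_a+y_b$. *)

theory Defs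
  imports "HOL-Probability.Probability"
begin

(* Conventions: [d] = {0..<d}, [K] = {0..<K}; matrices are functions nat => nat => real
   with indices restricted by explicit bounds; a diagonal matrix is given by its diagonal. *)

(* G-Latent model structure: G is a partition of {..<d} into K groups of size >= 3,
   gamma are the (nonnegative) diagonal entries of Gamma*. *)
definition glatent_model :: "nat \<Rightarrow> nat \<Rightarrow> (nat \<Rightarrow> nat set) \<Rightarrow> (nat \<Rightarrow> real) \<Rightarrow> bool" where
  "glatent_model d K G \<gamma> \<longleftrightarrow>
     K \<ge> 1 \<and>
     (\<forall>k<K. G k \<subseteq> {..<d} \<and> card (G k) \<ge> 3) \<and>
     (\<forall>k<K. \<forall>k'<K. k \<noteq> k' \<longrightarrow> G k \<inter> G k' = {}) \<and>
     (\<Union>k<K. G k) = {..<d} \<and>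
     (\<forall>j<d. \<gamma> j \<ge> 0)"

definition min_size :: "nat \<Rightarrow> (nat \<Rightarrow> nat set) \<Rightarrow> nat" where
  "min_size K G = Min {card (G k) | k. k < K}"

definition diag_norm :: "nat \<Rightarrow> (nat \<Rightarrow> real) \<Rightarrow> real" where
  "diag_norm d \<gamma> = Max {\<bar>\<gamma> j\<bar> | j. j < d}"

definition cov_of :: "nat \<Rightarrow> (nat \<Rightarrow> nat \<Rightarrow> real) \<Rightarrow> nat \<Rightarrow> nat \<Rightarrow> real" where
  "cov_of K L i j = (\<Sum>r<K. L i r * L j r)"

definition Delta :: "nat \<Rightarrow> (nat \<Rightarrow> nat \<Rightarrow> real) \<Rightarrow> real" where
  "Delta K C = Min {C j j + C k k - 2 * C j k | j k. j < k \<and> k < K}"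

(* Underlying probability space: i.i.d. standard normals w(l,r), l < n, r < K + d.
   Coordinates r < K drive the latent Z^l = L W^l ~ N(0, L L^T), coordinates K + j
   drive the noise E^l_j = sqrt(gamma_j) W'^l_j ~ N(0, gamma_j). *)
definition glatent_space :: "nat \<Rightarrow> nat \<Rightarrow> nat \<Rightarrow> (nat \<times> nat \<Rightarrow> real) measure" where
  "glatent_space n K d = PiM ({..<n} \<times> {..<K + d}) (\<lambda>_. density lborel std_normal_density)"

definition glatent_data :: "nat \<Rightarrow> nat \<Rightarrow> nat \<Rightarrow> (nat \<Rightarrow> nat set) \<Rightarrow> (nat \<Rightarrow> nat \<Rightarrow> real)
     \<Rightarrow> (nat \<Rightarrow> real) \<Rightarrow> (nat \<times> nat \<Rightarrow> real) \<Rightarrow> nat \<Rightarrow> nat \<Rightarrow> real" where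
  "glatent_data n d K G L \<gamma> w l j =
     (if l < n \<and> j < d then
        (\<Sum>k<K. if j \<in> G k then (\<Sum>r<K. L k r * w (l, r)) else 0) + sqrt (\<gamma> j) * w (l, K + j)
      else 0)"

definition emp_cov :: "nat \<Rightarrow> (nat \<Rightarrow> nat \<Rightarrow> real) \<Rightarrow> nat \<Rightarrow> nat \<Rightarrow> real" where
  "emp_cov n X a b = (1 / real n) * (\<Sum>l<n. X l a * X l b)"

(* Estimator assumption for a diagonal estimator Gh n d X (returns the diagonal, as a
   function of the sample size, the dimension and the data only). *)
definition estimator_assumption :: "real \<Rightarrow> real \<Rightarrow> real
     \<Rightarrow> (nat \<Rightarrow> nat \<Rightarrow> (nat \<Rightarrow> nat \<Rightarrow> real) \<Rightarrow> nat \<Rightarrow> real) \<Rightarrow> bool" where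
  "estimator_assumption p0 p1 p2 Gh \<longleftrightarrow>
     (\<forall>n d K G L \<gamma>. glatent_model d K G \<gamma> \<and> ln (real d) \<le> p0 * real n \<longrightarrow>
        (\<exists>A \<in> sets (glatent_space n K d).
           measure (glatent_space n K d) A \<ge> 1 - p2 / real d ^ 3 \<and>
           (\<forall>w \<in> A. \<forall>j<d.
              \<bar>Gh n d (glatent_data n d K G L \<gamma> w) j - \<gamma> j\<bar>
                \<le> p1 * diag_norm d \<gamma> * sqrt (ln (real d) / real n))))"

definition cert_y :: "(nat \<Rightarrow> nat \<Rightarrow> real) \<Rightarrow> real \<Rightarrow> nat set \<Rightarrow> nat \<Rightarrow> real" where
  "cert_y D yT S a =
     (\<Sum>b\<in>S. \<Sum>c\<in>S. D b c) / (2 * real (card S) ^ 2)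
     - (\<Sum>b\<in>S. D a b) / real (card S) - yT / (2 * real (card S))"

definition cert_Q :: "(nat \<Rightarrow> nat \<Rightarrow> real) \<Rightarrow> real \<Rightarrow> nat set \<Rightarrow> nat \<Rightarrow> nat \<Rightarrow> real" where
  "cert_Q D yT S a b = D a b + cert_y D yT S a + cert_y D yT S b + (if a = b then yT else 0)"

definition psd_on :: "nat set \<Rightarrow> (nat \<Rightarrow> nat \<Rightarrow> real) \<Rightarrow> bool" where
  "psd_on S Q \<longleftrightarrow> (\<forall>v :: nat \<Rightarrow> real. (\<Sum>a\<in>S. \<Sum>b\<in>S. v a * Q a b * v b) \<ge> 0)"

definition force_certificate :: "nat \<Rightarrow> (nat \<Rightarrow> nat set) \<Rightarrow> (nat \<Rightarrow> nat \<Rightarrow> real) \<Rightarrow> bool" where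
  "force_certificate K G D \<longleftrightarrow>
     (\<exists>yT \<ge> 0.
        (\<forall>i<K. psd_on (G i) (cert_Q D yT (G i))) \<and>
        (\<forall>i<K. \<forall>j<K. i \<noteq> j \<longrightarrow> (\<forall>a\<in>G i. \<forall>b\<in>G j.
            D a b + cert_y D yT (G i) a + cert_y D yT (G j) b \<ge> 0)))"

end

theory Submission
  imports Defs
begin

text \<open>
  Within a group of size \<open>s\<close>, \<open>Q = P (D + y\<^sub>T I) P\<close> where \<open>P = I - J / s\<close> kills the latent
  factors, so \<open>Q\<close> is positive semidefinite once \<open>y\<^sub>T\<close> dominates the operator norm of the centred
  noise covariance plus the error of the diagonal estimator. A net argument and chi-square tails bound
  that norm by a multiple of \<open>\<parallel>\<Gamma>\<parallel> (sqrt (d / n) + d / n)\<close>, simultaneously for all groups. For \<open>a\<close>, \<open>b\<close> in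
  different groups \<open>i\<close>, \<open>j\<close>, the value of \<open>y'\<close> at \<open>(a, b)\<close> is \<open>(C i i + C j j - 2 * C i j) / 2\<close> minus at most
  \<open>y\<^sub>T / m\<close> (whence the \<open>d / (n m\<^sup>2)\<close> and \<open>d / (n m)\<close> terms) and at most four times the entrywise
  deviation of \<open>D\<close> from its mean, which is of order \<open>\<sigma> sqrt (ln d / n)\<close> by polarization and a union
  bound over pairs.
\<close>

section \<open>Chi-square concentration for linear functionals of Gaussian samples\<close>

text \<open>Collecting exponents: tilting the standard normal density by
  \<open>exp (c * x\<^sup>2)\<close> leaves a centred normal density of variance
  \<open>1 / (1 - 2 * c)\<close> times its mass. That mass is the moment generating function of a
  squared standard normal.\<close>

lemma normal_density_times_exp_square:
  fixes c x :: real
  assumes "c < 1 / 2"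
  shows "std_normal_density x * exp (c * x\<^sup>2)
    = 1 / sqrt (1 - 2 * c) * normal_density 0 (1 / sqrt (1 - 2 * c)) x"
proof -
  have p: "1 - 2 * c > 0" using assms by simp
  have s: "(1 / sqrt (1 - 2 * c))\<^sup>2 = 1 / (1 - 2 * c)"
    using p by (simp add: power_divide)
  have e: "- x\<^sup>2 / 2 + c * x\<^sup>2 = - (x - 0)\<^sup>2 / (2 * (1 / sqrt (1 - 2 * c))\<^sup>2)"
    unfolding s using p by (simp add: field_simps)
  have r: "sqrt (2 * pi * (1 / (1 - 2 * c))) = sqrt (2 * pi) / sqrt (1 - 2 * c)"
    by (simp add: real_sqrt_mult real_sqrt_divide)
  have "std_normal_density x * exp (c * x\<^sup>2) = 1 / sqrt (2 * pi) * exp (- x\<^sup>2 / 2 + c * x\<^sup>2)"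
    by (simp add: std_normal_density_def mult_exp_exp add.commute)
  also have "\<dots> = 1 / sqrt (1 - 2 * c) * normal_density 0 (1 / sqrt (1 - 2 * c)) x"
    unfolding normal_density_def e
    using p by (simp only: s r) (simp add: field_simps)
  finally show ?thesis .
qed

text \<open>The left side is the moment generating function of a centred squared normal. After
  taking logarithms the claim reads \<open>f c \<ge> 0\<close> with \<open>f\<close> as below. Here
  \<open>f 0 = 0\<close>, and the derivative \<open>4 * x * (1 - 4 * x) / (1 - 2 * x)\<close> is
  nonpositive left of 0 and nonnegative right of 0 on the admissible range, so 0 is a
  minimum.\<close>

lemma exp_le_sqrt_one_minus:
  fixes c :: real
  assumes "\<bar>c\<bar> \<le> 1 / 4"
  shows "exp (- c) / sqrt (1 - 2 * c) \<le> exp (2 * c\<^sup>2)"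
proof -
  define f where "f = (\<lambda>x::real. 4 * x\<^sup>2 + 2 * x + ln (1 - 2 * x))"
  have d: "(f has_real_derivative (8 * x + 2 - 2 / (1 - 2 * x))) (at x)" if "\<bar>x\<bar> \<le> 1 / 4" for x
    unfolding f_def using that by (auto intro!: derivative_eq_intros simp: field_simps abs_le_iff)
  have eq: "8 * x + 2 - 2 / (1 - 2 * x) = 4 * x * (1 - 4 * x) / (1 - 2 * x)" if "\<bar>x\<bar> \<le> 1 / 4" for x :: real
    using that by (auto simp: field_simps abs_le_iff)
  have "f c \<ge> f 0"
  proof (cases "c \<ge> 0")
    case True
    show ?thesis
    proof (rule DERIV_nonneg_imp_nondecreasing[of 0 c f, OF True])
      fix x :: real assume "0 \<le> x" "x \<le> c"
      then have x: "\<bar>x\<bar> \<le> 1 / 4" "0 \<le> x" "x \<le> 1/4" using assms by auto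
      show "\<exists>y. (f has_real_derivative y) (at x) \<and> 0 \<le> y"
        using d[OF x(1)] eq[OF x(1)] x by (intro exI[of _ "8 * x + 2 - 2 / (1 - 2 * x)"]) simp
    qed
  next
    case False
    show ?thesis
    proof (rule DERIV_nonpos_imp_nonincreasing[of c 0 f])
      show "c \<le> 0" using False by simp
      fix x :: real assume "c \<le> x" "x \<le> 0"
      then have x: "\<bar>x\<bar> \<le> 1 / 4" "x \<le> 0" using assms by auto
      have "4 * x * (1 - 4 * x) / (1 - 2 * x) \<le> 0"
        using x by (intro divide_nonpos_pos mult_nonpos_nonneg[of "4 * x"]) auto
      then show "\<exists>y. (f has_real_derivative y) (at x) \<and> y \<le> 0"
        using d[OF x(1)] eq[OF x(1)] by (intro exI[of _ "8 * x + 2 - 2 / (1 - 2 * x)"]) simp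
    qed
  qed
  then have l: "- c - ln (1 - 2 * c) / 2 \<le> 2 * c\<^sup>2" by (simp add: f_def)
  have p: "1 - 2 * c > 0" using assms by (simp add: abs_le_iff)
  have "exp (- c) / sqrt (1 - 2 * c) = exp (- c - ln (1 - 2 * c) / 2)"
    using p by (simp add: exp_diff ln_sqrt[symmetric])
  then show ?thesis using l by simp
qed

context prob_space
begin

lemma std_normal_exp_square:
  fixes X :: "'a \<Rightarrow> real" and c :: real
  assumes X: "distributed M lborel X std_normal_density" and c: "\<bar>c\<bar> \<le> 1 / 4"
  shows "integrable M (\<lambda>x. exp (c * ((X x)\<^sup>2 - 1)))"
    and "expectation (\<lambda>x. exp (c * ((X x)\<^sup>2 - 1))) \<le> exp (2 * c\<^sup>2)"
proof -
  have c2: "c < 1 / 2" using c by (simp add: abs_le_iff)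
  define s where "s = 1 / sqrt (1 - 2 * c)"
  have sp: "s > 0" using c2 by (simp add: s_def)
  have eq: "std_normal_density x * exp (c * (x\<^sup>2 - 1)) = exp (- c) * s * normal_density 0 s x" for x
    using normal_density_times_exp_square[OF c2, of x]
    by (simp add: s_def right_diff_distrib exp_diff exp_minus field_simps)
  show "integrable M (\<lambda>x. exp (c * ((X x)\<^sup>2 - 1)))"
    using distributed_integrable[OF X, of "\<lambda>x. exp (c * (x\<^sup>2 - 1))"] sp
    by (simp add: eq)
  have "expectation (\<lambda>x. exp (c * ((X x)\<^sup>2 - 1))) = exp (- c) * s"
    using distributed_integral[OF X, of "\<lambda>x. exp (c * (x\<^sup>2 - 1))"] sp by (simp add: eq)
  then show "expectation (\<lambda>x. exp (c * ((X x)\<^sup>2 - 1))) \<le> exp (2 * c\<^sup>2)"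
    using exp_le_sqrt_one_minus[OF c] by (simp add: s_def)
qed

text \<open>Chernoff bound: Markov's inequality for the exponential, whose expectation factorizes by
  independence. The sign of \<open>c\<close> is free, so both tails are covered.\<close>

lemma chi_square_exp_markov:
  fixes X :: "'i \<Rightarrow> 'a \<Rightarrow> real" and c t :: real
  assumes L: "finite L" and ind: "indep_vars (\<lambda>_. borel) X L"
    and X: "\<And>l. l \<in> L \<Longrightarrow> distributed M lborel (X l) std_normal_density"
    and c: "\<bar>c\<bar> \<le> 1 / 4"
  shows "prob {x \<in> space M. c * (\<Sum>l\<in>L. (X l x)\<^sup>2 - 1) \<ge> real (card L) * t}
    \<le> exp (real (card L) * (2 * c\<^sup>2 - t))"
proof -
  have ind': "indep_vars (\<lambda>_. borel) (\<lambda>l x. exp (c * ((X l x)\<^sup>2 - 1))) L"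
    by (rule indep_vars_compose2[OF ind]) measurable
  have i: "integrable M (\<lambda>x. exp (c * ((X l x)\<^sup>2 - 1)))" if "l \<in> L" for l
    by (rule std_normal_exp_square(1)[OF X[OF that] c])
  note P = indep_vars_lebesgue_integral[OF L ind' i]
    and I = indep_vars_integrable[OF L ind' i]
  have pr: "(\<Prod>l\<in>L. exp (c * ((X l x)\<^sup>2 - 1))) = exp (c * (\<Sum>l\<in>L. (X l x)\<^sup>2 - 1))" for x
    by (simp add: exp_sum[OF L] sum_distrib_left)
  have "prob {x \<in> space M. c * (\<Sum>l\<in>L. (X l x)\<^sup>2 - 1) \<ge> real (card L) * t}
      = prob {x \<in> space M. (\<Prod>l\<in>L. exp (c * ((X l x)\<^sup>2 - 1))) \<ge> exp (real (card L) * t)}"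
    unfolding pr by simp
  also have "\<dots> \<le> expectation (\<lambda>x. \<Prod>l\<in>L. exp (c * ((X l x)\<^sup>2 - 1))) / exp (real (card L) * t)"
    by (rule integral_Markov_inequality_measure[OF I, of "{}"]) (auto intro!: prod_nonneg)
  also have "\<dots> \<le> (\<Prod>l\<in>L. exp (2 * c\<^sup>2)) / exp (real (card L) * t)"
    by (subst P, assumption, intro divide_right_mono prod_mono)
      (auto intro!: std_normal_exp_square(2)[OF X c] integral_nonneg)
  also have "\<dots> = exp (real (card L) * (2 * c\<^sup>2 - t))"
    by (simp add: exp_of_nat_mult[symmetric] exp_diff[symmetric] right_diff_distrib)
  finally show ?thesis .
qed

lemma chi_square_tail:
  fixes X :: "'i \<Rightarrow> 'a \<Rightarrow> real" and t :: real
  assumes L: "finite L" and ind: "indep_vars (\<lambda>_. borel) X L"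
    and X: "\<And>l. l \<in> L \<Longrightarrow> distributed M lborel (X l) std_normal_density"
    and t: "t \<ge> 0"
  shows "prob {x \<in> space M. \<bar>\<Sum>l\<in>L. (X l x)\<^sup>2 - 1\<bar> \<ge> real (card L) * t}
    \<le> 2 * exp (- real (card L) * min t (t\<^sup>2) / 8)"
proof -
  \<comment> \<open>The exponent \<open>2 * c\<^sup>2 - c * t\<close> is minimal at
    \<open>t / 4\<close>; capping at \<open>1 / 4\<close> keeps the bound on the generating function
    valid. The result is \<open>- t\<^sup>2 / 8\<close> for \<open>t \<le> 1\<close> and
    \<open>1 / 8 - t / 4 \<le> - t / 8\<close> beyond.\<close>
  define c where "c = min t 1 / 4"
  have c: "\<bar>c\<bar> \<le> 1 / 4" "\<bar>- c\<bar> \<le> 1 / 4" "c \<ge> 0" using t by (auto simp: c_def)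
  have ex: "2 * c\<^sup>2 - c * t \<le> - min t (t\<^sup>2) / 8"
  proof (cases "t \<le> 1")
    case True
    then have "min t (t\<^sup>2) = t\<^sup>2" using t by (simp add: power2_eq_square mult_left_le)
    then show ?thesis using True by (simp add: c_def power2_eq_square)
  next
    case False
    then have "min t (t\<^sup>2) = t" by (simp add: min_def power2_eq_square)
    then show ?thesis using False by (simp add: c_def power2_eq_square)
  qed
  have rv[measurable]: "random_variable borel (X l)" if "l \<in> L" for l
    using ind that by (auto simp: indep_vars_def)
  define S where "S = (\<lambda>x. \<Sum>l\<in>L. (X l x)\<^sup>2 - 1)"
  have [measurable]: "random_variable borel S" unfolding S_def by measurable
  have sub: "{x \<in> space M. \<bar>S x\<bar> \<ge> real (card L) * t}
      \<subseteq> {x \<in> space M. c * S x \<ge> real (card L) * (c * t)} \<union> {x \<in> space M. - c * S x \<ge> real (card L) * (c * t)}"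
  proof
    fix x assume x: "x \<in> {x \<in> space M. \<bar>S x\<bar> \<ge> real (card L) * t}"
    have "c * \<bar>S x\<bar> \<ge> c * (real (card L) * t)"
      using x c(3) by (intro mult_left_mono) auto
    then show "x \<in> {x \<in> space M. c * S x \<ge> real (card L) * (c * t)} \<union> {x \<in> space M. - c * S x \<ge> real (card L) * (c * t)}"
      using x by (auto simp: abs_if mult_ac split: if_splits)
  qed
  have "prob {x \<in> space M. \<bar>S x\<bar> \<ge> real (card L) * t}
    \<le> prob ({x \<in> space M. c * S x \<ge> real (card L) * (c * t)} \<union> {x \<in> space M. - c * S x \<ge> real (card L) * (c * t)})"
    by (rule finite_measure_mono[OF sub]) measurable
  also have "\<dots> \<le> prob {x \<in> space M. c * S x \<ge> real (card L) * (c * t)} + prob {x \<in> space M. - c * S x \<ge> real (card L) * (c * t)}"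
    by (rule measure_Un_le) measurable
  also have "\<dots> \<le> exp (real (card L) * (2 * c\<^sup>2 - c * t)) + exp (real (card L) * (2 * (- c)\<^sup>2 - c * t))"
    unfolding S_def by (intro add_mono chi_square_exp_markov[OF L ind X] c)
  also have "\<dots> = 2 * exp (real (card L) * (2 * c\<^sup>2 - c * t))" by simp
  also have "\<dots> \<le> 2 * exp (real (card L) * (- min t (t\<^sup>2) / 8))"
    using mult_left_mono[OF ex, of "real (card L)"] by simp
  finally show ?thesis by (simp add: S_def)
qed

end

section \<open>Linear functionals of independent standard normals\<close>

lemma std_normal_PiM_component:
  assumes "i \<in> I"
  shows "distr (PiM I (\<lambda>_. density lborel std_normal_density)) borel (\<lambda>w. w i) = density lborel std_normal_density"
proof -
  have "distr (PiM I (\<lambda>_. density lborel std_normal_density)) borel (\<lambda>w. w i)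
      = distr (PiM I (\<lambda>_. density lborel std_normal_density)) (density lborel std_normal_density) (\<lambda>w. w i)"
    by (rule distr_cong) auto
  then show ?thesis
    using distr_PiM_component[of I "\<lambda>_. density lborel std_normal_density" i] assms
    by (simp add: prob_space_normal_density)
qed

lemma prob_space_std_normal_PiM:
  "prob_space (PiM I (\<lambda>_. density lborel std_normal_density))"
  by (intro prob_space_PiM prob_space_normal_density) simp

text \<open>Independence means that the joint law is the product of the marginals; the joint law of
  the coordinates is the product measure itself.\<close>

lemma indep_vars_std_normal_PiM:
  assumes "I \<noteq> {}"
  shows "prob_space.indep_vars (PiM I (\<lambda>_. density lborel std_normal_density)) (\<lambda>_. borel) (\<lambda>i w. w i :: real) I"
proof -
  let ?N = "\<lambda>_. density lborel (\<lambda>x. ennreal (std_normal_density x))"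
  interpret prob_space "PiM I ?N" by (rule prob_space_std_normal_PiM)
  have rv: "(\<lambda>w. w i) \<in> PiM I ?N \<rightarrow>\<^sub>M borel" if "i \<in> I" for i
    using measurable_component_singleton[OF that, of ?N] by (simp cong: measurable_cong_sets)
  have "distr (PiM I ?N) (PiM I (\<lambda>_. borel)) (\<lambda>x. \<lambda>i\<in>I. x i) = distr (PiM I ?N) (PiM I ?N) (\<lambda>x. x)"
    by (rule distr_cong) (auto simp: space_PiM intro!: sets_PiM_cong)
  also have "\<dots> = PiM I ?N" by (rule distr_id2) simp
  also have "\<dots> = PiM I (\<lambda>i. distr (PiM I ?N) borel (\<lambda>w. w i))"
    by (intro PiM_cong refl) (simp add: std_normal_PiM_component)
  finally show ?thesis
    by (subst indep_vars_iff_distr_eq_PiM'[OF assms rv])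
qed

text \<open>Rotation invariance: a unit combination of independent standard normals is standard
  normal. Different rows \<open>l\<close> use disjoint blocks of coordinates, which gives
  independence over \<open>l\<close>.\<close>

lemma std_normal_PiM_linear:
  fixes u :: "'r \<Rightarrow> real"
  assumes L: "finite L" "L \<noteq> {}" and R: "finite R" and u: "(\<Sum>r\<in>R. (u r)\<^sup>2) = 1"
  defines "M \<equiv> PiM (L \<times> R) (\<lambda>_. density lborel std_normal_density)"
  shows "prob_space.indep_vars M (\<lambda>_. borel) (\<lambda>l w. \<Sum>r\<in>R. u r * w (l, r)) L"
    and "l \<in> L \<Longrightarrow> distributed M lborel (\<lambda>w. \<Sum>r\<in>R. u r * w (l, r)) std_normal_density"
proof -
  have Rne: "R \<noteq> {}" using u by auto
  interpret prob_space M unfolding M_def by (rule prob_space_std_normal_PiM)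
  have ind: "indep_vars (\<lambda>_. borel) (\<lambda>i w. w i :: real) (L \<times> R)"
    unfolding M_def using L Rne by (intro indep_vars_std_normal_PiM) auto
  have "indep_vars (\<lambda>l. PiM ({l} \<times> R) (\<lambda>_. borel)) (\<lambda>l w. restrict (\<lambda>i. w i) ({l} \<times> R)) L"
    by (rule indep_vars_restrict[OF ind]) (auto simp: disjoint_family_on_def)
  from indep_vars_compose2[OF this, of "\<lambda>l w. \<Sum>r\<in>R. u r * w (l, r)" "\<lambda>_. borel"]
  have "indep_vars (\<lambda>_. borel) (\<lambda>l w. \<Sum>r\<in>R. u r * (restrict (\<lambda>i. w i) ({l} \<times> R)) (l, r)) L"
    by measurable
  then show "indep_vars (\<lambda>_. borel) (\<lambda>l w. \<Sum>r\<in>R. u r * w (l, r)) L"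
    by simp
  assume l: "l \<in> L"
  \<comment> \<open>The law of a sum of independent normals is available for positive standard
    deviations, so coordinates with \<open>u r = 0\<close> are removed first.\<close>
  define R' where "R' = {r \<in> R. u r \<noteq> 0}"
  have R': "finite R'" "R' \<subseteq> R" using R by (auto simp: R'_def)
  have su: "(\<Sum>r\<in>R'. (u r)\<^sup>2) = 1"
    unfolding u[symmetric] R'_def by (rule sum.mono_neutral_left) (use R in auto)
  have ne: "R' \<noteq> {}" using su by auto
  have "indep_vars (\<lambda>r. PiM {(l, r)} (\<lambda>_. borel)) (\<lambda>r w. restrict (\<lambda>i. w i) {(l, r)}) R'"
    using l R' by (intro indep_vars_restrict[OF ind]) (auto simp: disjoint_family_on_def)
  from indep_vars_compose2[OF this, of "\<lambda>r w. u r * w (l, r)" "\<lambda>_. borel"]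
  have i2: "indep_vars (\<lambda>_. borel) (\<lambda>r w. u r * w (l, r)) R'"
    by simp
  have n: "distributed M lborel (\<lambda>w. u r * w (l, r)) (normal_density 0 \<bar>u r\<bar>)" if "r \<in> R'" for r
  proof -
    have "(\<lambda>w. w (l, r)) \<in> M \<rightarrow>\<^sub>M borel"
      using indep_vars_subset[OF ind, of "{(l, r)}"] l that R' unfolding indep_vars_def by auto
    then have "distributed M lborel (\<lambda>w. w (l, r)) std_normal_density"
      unfolding distributed_def using l that R' std_normal_PiM_component[of "(l, r)" "L \<times> R"]
      by (auto simp: M_def cong: distr_cong)
    from normal_density_affine[OF this, of "u r" 0] show ?thesis
      using that by (simp add: R'_def)
  qed
  have "distributed M lborel (\<lambda>w. \<Sum>r\<in>R'. u r * w (l, r)) (normal_density (\<Sum>r\<in>R'. 0) (sqrt (\<Sum>r\<in>R'. \<bar>u r\<bar>\<^sup>2)))"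
    by (rule sum_indep_normal[OF R'(1) ne i2 _ n]) (auto simp: R'_def)
  also have "(\<lambda>w. \<Sum>r\<in>R'. u r * w (l, r)) = (\<lambda>w. \<Sum>r\<in>R. u r * w (l, r))"
    by (rule ext, rule sum.mono_neutral_left) (use R in \<open>auto simp: R'_def\<close>)
  finally show "distributed M lborel (\<lambda>w. \<Sum>r\<in>R. u r * w (l, r)) std_normal_density"
    by (simp add: su)
qed

text \<open>The strict inequality keeps the event empty when \<open>u = 0\<close>.\<close>

lemma std_normal_PiM_quadratic_tail:
  fixes u :: "'r \<Rightarrow> real" and t :: real
  assumes L: "finite L" "L \<noteq> {}" and R: "finite R" and t: "t \<ge> 0"
  assumes M_def: "M = PiM (L \<times> R) (\<lambda>_. density lborel std_normal_density)"
    and E_def: "E = {w \<in> space M. \<bar>(1 / real (card L)) * (\<Sum>l\<in>L. (\<Sum>r\<in>R. u r * w (l, r))\<^sup>2) - (\<Sum>r\<in>R. (u r)\<^sup>2)\<bar>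
        > (\<Sum>r\<in>R. (u r)\<^sup>2) * t}"
  shows "E \<in> sets M" and "measure M E \<le> 2 * exp (- real (card L) * min t (t\<^sup>2) / 8)"
proof -
  interpret prob_space M unfolding M_def by (rule prob_space_std_normal_PiM)
  have c[measurable]: "(\<lambda>w. w (l, r)) \<in> M \<rightarrow>\<^sub>M borel" if "l \<in> L" "r \<in> R" for l r
    using measurable_component_singleton[of "(l, r)" "L \<times> R" "\<lambda>_. density lborel (\<lambda>x. ennreal (std_normal_density x))"] that
    by (simp add: M_def cong: measurable_cong_sets)
  show Em[measurable]: "E \<in> sets M" unfolding E_def by measurable
  define s where "s = (\<Sum>r\<in>R. (u r)\<^sup>2)"
  show "measure M E \<le> 2 * exp (- real (card L) * min t (t\<^sup>2) / 8)"
  proof (cases "s = 0")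
    case True
    then have "u r = 0" if "r \<in> R" for r
      using that R by (simp add: s_def sum_nonneg_eq_0_iff)
    then have "E = {}" by (auto simp: E_def)
    then show ?thesis by simp
  next
    case False
    have sp: "s > 0" using False sum_nonneg[of R "\<lambda>r. (u r)\<^sup>2"] by (simp add: s_def)
    define v where "v r = u r / sqrt s" for r
    define Y where "Y l w = (\<Sum>r\<in>R. v r * w (l, r))" for l and w :: "'a \<times> 'r \<Rightarrow> real"
    have v: "(\<Sum>r\<in>R. (v r)\<^sup>2) = 1"
      using sp by (simp add: v_def power_divide sum_divide_distrib[symmetric] s_def[symmetric])
    have uY: "(\<Sum>r\<in>R. u r * w (l, r)) = sqrt s * Y l w" for l w
      using sp by (simp add: Y_def v_def sum_distrib_left)
    have n: "real (card L) > 0" using L by (simp add: card_gt_0_iff)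
    have "E \<subseteq> {w \<in> space M. \<bar>\<Sum>l\<in>L. (Y l w)\<^sup>2 - 1\<bar> \<ge> real (card L) * t}"
    proof
      fix w assume w: "w \<in> E"
      have "(1 / real (card L)) * (\<Sum>l\<in>L. (\<Sum>r\<in>R. u r * w (l, r))\<^sup>2) - (\<Sum>r\<in>R. (u r)\<^sup>2)
          = s * ((\<Sum>l\<in>L. (Y l w)\<^sup>2 - 1) / real (card L))"
        using n sp by (simp add: uY power_mult_distrib sum_distrib_left[symmetric] s_def[symmetric]
            sum_subtractf field_simps)
      then have "s * t < s * (\<bar>\<Sum>l\<in>L. (Y l w)\<^sup>2 - 1\<bar> / real (card L))"
        using w sp by (simp add: E_def s_def[symmetric] abs_mult)
      then have "t < \<bar>\<Sum>l\<in>L. (Y l w)\<^sup>2 - 1\<bar> / real (card L)"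
        using sp by (simp only: mult_less_cancel_left_pos)
      then show "w \<in> {w \<in> space M. \<bar>\<Sum>l\<in>L. (Y l w)\<^sup>2 - 1\<bar> \<ge> real (card L) * t}"
        using n w by (simp add: E_def field_simps)
    qed
    then have "measure M E \<le> measure M {w \<in> space M. \<bar>\<Sum>l\<in>L. (Y l w)\<^sup>2 - 1\<bar> \<ge> real (card L) * t}"
      unfolding Y_def by (intro finite_measure_mono) measurable
    also have "\<dots> \<le> 2 * exp (- real (card L) * min t (t\<^sup>2) / 8)"
      unfolding Y_def
      using std_normal_PiM_linear[OF L R v] t
      by (intro chi_square_tail[OF L(1)]) (auto simp: M_def)
    finally show ?thesis .
  qed
qed

section \<open>Quadratic forms on an integer net\<close>

text \<open>Lattice points of Euclidean norm at most \<open>4 * sqrt d\<close>; scaled by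
  \<open>1 / (4 * sqrt d)\<close> they form a net of the unit ball. Extensional functions make the
  set finite.\<close>

definition integer_net :: "nat \<Rightarrow> (nat \<Rightarrow> int) set" where
  "integer_net d = {k \<in> {..<d} \<rightarrow>\<^sub>E UNIV. (\<Sum>a<d. (k a)\<^sup>2) \<le> 16 * int d}"

text \<open>The factor of a single coordinate in the weight count for the net; each step of the
  induction adds the two endpoints of the interval.\<close>

lemma sum_half_power_abs: "(\<Sum>j=- int N..int N. (1 / 2 :: real) ^ nat \<bar>j\<bar>) = 3 - 2 * (1 / 2) ^ N"
proof (induction N)
  case (Suc N)
  have "{- int (Suc N)..int (Suc N)} = insert (- int (Suc N)) (insert (int (Suc N)) {- int N..int N})"
    by auto
  then have "(\<Sum>j=- int (Suc N)..int (Suc N). (1 / 2 :: real) ^ nat \<bar>j\<bar>)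
      = 2 * (1 / 2) ^ Suc N + (\<Sum>j=- int N..int N. (1 / 2 :: real) ^ nat \<bar>j\<bar>)"
    by (simp add: nat_add_distrib)
  with Suc show ?case by simp
qed simp

text \<open>The sum stays below 3; the bound 4 is a power of two and merges with
  \<open>2 ^ (16 * d)\<close> into \<open>2 ^ (18 * d)\<close>.\<close>

lemma sum_half_power_abs_le: "(\<Sum>j=- int N..int N. (1 / 2 :: real) ^ nat \<bar>j\<bar>) \<le> 4"
proof -
  have "(1 / 2 :: real) ^ N \<ge> 0" by simp
  then show ?thesis unfolding sum_half_power_abs by linarith
qed

lemma abs_le_square_int: "\<bar>j\<bar> \<le> (j::int)\<^sup>2"
proof (cases "j = 0")
  case False
  then have "\<bar>j\<bar> * 1 \<le> \<bar>j\<bar> * \<bar>j\<bar>" by (intro mult_left_mono) auto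
  then show ?thesis by (simp add: power2_eq_square abs_mult_self_eq)
qed simp

text \<open>Each \<open>\<bar>k a\<bar>\<close> is at most \<open>(k a)\<^sup>2\<close>, hence at
  most the whole sum. The crude box yields finiteness and is the domain over which the weights
  factorize.\<close>

lemma integer_net_subset: "integer_net d \<subseteq> {..<d} \<rightarrow>\<^sub>E {- int (16 * d)..int (16 * d)}"
proof
  fix k assume k: "k \<in> integer_net d"
  have "\<bar>k a\<bar> \<le> 16 * int d" if "a < d" for a
  proof -
    have "\<bar>k a\<bar> \<le> (k a)\<^sup>2" by (rule abs_le_square_int)
    also have "\<dots> \<le> (\<Sum>a<d. (k a)\<^sup>2)" using that by (intro member_le_sum) auto
    finally show ?thesis using k by (simp add: integer_net_def)
  qed
  then show "k \<in> {..<d} \<rightarrow>\<^sub>E {- int (16 * d)..int (16 * d)}"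
    using k by (auto simp: integer_net_def PiE_iff abs_le_iff minus_le_iff)
qed

lemma finite_integer_net: "finite (integer_net d)"
  by (rule finite_subset[OF integer_net_subset]) (intro finite_PiE; simp)

text \<open>Every point \<open>k\<close> of the net has weight \<open>2 ^ (16 * d) * (\<Prod>a<d. (1 / 2) ^ \<bar>k a\<bar>) \<ge> 1\<close>,
  and the total weight over a box factorizes.\<close>

lemma card_integer_net: "real (card (integer_net d)) \<le> 2 ^ (18 * d)"
proof -
  let ?B = "\<lambda>_::nat. {- int (16 * d)..int (16 * d)}"
  let ?h = "\<lambda>k. 2 ^ (16 * d) * (\<Prod>a<d. (1 / 2 :: real) ^ nat \<bar>k a\<bar>)"
  have w: "1 \<le> ?h k" if "k \<in> integer_net d" for k
  proof -
    have "int (\<Sum>a<d. nat \<bar>k a\<bar>) = (\<Sum>a<d. \<bar>k a\<bar>)" by simp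
    also have "\<dots> \<le> (\<Sum>a<d. (k a)\<^sup>2)" by (intro sum_mono abs_le_square_int)
    also have "\<dots> \<le> int (16 * d)" using that by (simp add: integer_net_def)
    finally have le: "(\<Sum>a<d. nat \<bar>k a\<bar>) \<le> 16 * d" by linarith
    have "1 = 2 ^ (16 * d) * (1 / 2 :: real) ^ (16 * d)"
      by (simp only: power_mult_distrib[symmetric]) simp
    also have "\<dots> \<le> 2 ^ (16 * d) * (1 / 2) ^ (\<Sum>a<d. nat \<bar>k a\<bar>)"
      by (intro mult_left_mono power_decreasing le) auto
    also have "\<dots> = ?h k" by (simp add: power_sum)
    finally show ?thesis .
  qed
  have sub: "integer_net d \<subseteq> Pi\<^sub>E {..<d} ?B" by (rule integer_net_subset)
  have fin: "finite (Pi\<^sub>E {..<d} ?B)" by (intro finite_PiE) auto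
  have "real (card (integer_net d)) = (\<Sum>k\<in>integer_net d. 1)" by simp
  also have "\<dots> \<le> (\<Sum>k\<in>integer_net d. ?h k)" by (rule sum_mono) (rule w)
  also have "\<dots> \<le> (\<Sum>k\<in>Pi\<^sub>E {..<d} ?B. ?h k)"
    by (rule sum_mono2[OF fin sub]) (simp add: prod_nonneg)
  also have "\<dots> = 2 ^ (16 * d) * (\<Prod>a<d. \<Sum>j\<in>?B a. (1 / 2 :: real) ^ nat \<bar>j\<bar>)"
    unfolding sum_distrib_left[symmetric] by (subst prod_sum_PiE) auto
  also have "\<dots> \<le> 2 ^ (16 * d) * (\<Prod>a<d. 4)"
    by (intro mult_left_mono prod_mono conjI sum_nonneg sum_half_power_abs_le) auto
  also have "\<dots> = (2 ^ 16 * 4) ^ d"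
    by (simp only: prod_constant card_lessThan power_mult power_mult_distrib)
  also have "\<dots> = (2 ^ 18) ^ d" by simp
  finally show ?thesis by (simp only: power_mult)
qed

text \<open>Rounding towards zero, unlike rounding to the nearest integer, never increases the
  absolute value, so a rounded vector stays in the ball that defines the net.\<close>

lemma ex_round_towards_zero:
  fixes x :: real
  shows "\<exists>k. \<bar>real_of_int k\<bar> \<le> \<bar>x\<bar> \<and> \<bar>x - real_of_int k\<bar> \<le> 1"
proof (cases "x \<ge> 0")
  case True
  then have "\<lfloor>x\<rfloor> \<ge> 0" by simp
  then show ?thesis using True by (intro exI[of _ "\<lfloor>x\<rfloor>"]) (simp; linarith)
next
  case False
  then have "\<lceil>x\<rceil> \<le> 0" by simp
  then show ?thesis using False by (intro exI[of _ "\<lceil>x\<rceil>"]) (simp; linarith)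
qed

section \<open>Quadratic forms controlled by their values on the net\<close>

definition bilin :: "nat \<Rightarrow> (nat \<Rightarrow> nat \<Rightarrow> real) \<Rightarrow> (nat \<Rightarrow> real) \<Rightarrow> (nat \<Rightarrow> real) \<Rightarrow> real" where
  "bilin d M v w = (\<Sum>a<d. \<Sum>b<d. v a * M a b * w b)"

lemma bilin_add_scale_left:
  "bilin d M (\<lambda>a. v a + s * v' a) w = bilin d M v w + s * bilin d M v' w"
  by (simp add: bilin_def sum_distrib_left sum.distrib[symmetric] algebra_simps)

lemma bilin_add_scale_right:
  "bilin d M v (\<lambda>a. w a + s * w' a) = bilin d M v w + s * bilin d M v w'"
  by (simp add: bilin_def sum_distrib_left sum.distrib[symmetric] algebra_simps)

lemma bilin_scale: "bilin d M (\<lambda>a. s * v a) (\<lambda>a. s * v a) = s\<^sup>2 * bilin d M v v"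
  by (simp add: bilin_def sum_distrib_left power2_eq_square mult_ac)

text \<open>Rounding \<open>4 * sqrt d * v\<close> towards zero gives a net point \<open>w\<close> within \<open>1 / 4\<close> of \<open>v\<close>; writing
  \<open>v = w + u / 4\<close> with \<open>u\<close> in the unit ball bounds the supremum of the form over the unit ball by \<open>\<tau>\<close>
  plus \<open>9 / 16\<close> of itself.\<close>

lemma bilin_le_of_integer_net:
  fixes M :: "nat \<Rightarrow> nat \<Rightarrow> real"
  assumes d: "d > 0" and \<tau>: "\<tau> \<ge> 0" and sym: "\<And>a b. M a b = M b a"
    and net: "\<And>k. k \<in> integer_net d \<Longrightarrow>
      \<bar>bilin d M (\<lambda>a. real_of_int (k a)) (\<lambda>a. real_of_int (k a))\<bar> \<le> \<tau> * (\<Sum>a<d. (real_of_int (k a))\<^sup>2)"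
  shows "\<bar>bilin d M v v\<bar> \<le> 4 * \<tau> * (\<Sum>a<d. (v a)\<^sup>2)"
proof -
  define ball where "ball = {v :: nat \<Rightarrow> real. (\<Sum>a<d. (v a)\<^sup>2) \<le> 1}"
  define N where "N = Sup ((\<lambda>v. \<bar>bilin d M v v\<bar>) ` ball)"
  \<comment> \<open>Boundedness makes \<open>N\<close> a genuine upper bound: on the ball every
    coordinate is at most 1 in absolute value, so the sum of all \<open>\<bar>M a b\<bar>\<close>
    bounds the form.\<close>
  have "bdd_above ((\<lambda>v. \<bar>bilin d M v v\<bar>) ` ball)"
  proof (rule bdd_aboveI2)
    fix v assume v: "v \<in> ball"
    have le: "\<bar>v a\<bar> \<le> 1" if "a < d" for a
    proof -
      have "(v a)\<^sup>2 \<le> (\<Sum>a<d. (v a)\<^sup>2)" using that by (intro member_le_sum) auto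
      then show ?thesis using v unfolding ball_def abs_square_le_1[symmetric] by simp
    qed
    have "\<bar>bilin d M v v\<bar> \<le> (\<Sum>a<d. \<Sum>b<d. \<bar>v a * M a b * v b\<bar>)"
      unfolding bilin_def by (intro order_trans[OF sum_abs] sum_mono sum_abs)
    also have "\<dots> \<le> (\<Sum>a<d. \<Sum>b<d. 1 * \<bar>M a b\<bar> * 1)"
      unfolding abs_mult by (intro sum_mono mult_mono le) auto
    finally show "\<bar>bilin d M v v\<bar> \<le> (\<Sum>a<d. \<Sum>b<d. 1 * \<bar>M a b\<bar> * 1)" .
  qed
  then have N1: "\<bar>bilin d M v v\<bar> \<le> N" if "v \<in> ball" for v
    unfolding N_def using that by (intro cSup_upper) auto
  have "(\<lambda>_. 0) \<in> ball" by (simp add: ball_def)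
  then have ne: "ball \<noteq> {}" by auto
  have N: "\<bar>bilin d M v v\<bar> \<le> N * (\<Sum>a<d. (v a)\<^sup>2)" for v
  proof (cases "(\<Sum>a<d. (v a)\<^sup>2) = 0")
    case True
    then have "v a = 0" if "a < d" for a using that by (simp add: sum_nonneg_eq_0_iff)
    then show ?thesis using True by (simp add: bilin_def)
  next
    case False
    define s where "s = (\<Sum>a<d. (v a)\<^sup>2)"
    have s: "s > 0" using False sum_nonneg[of "{..<d}" "\<lambda>a. (v a)\<^sup>2"] by (simp add: s_def)
    have "(\<lambda>a. 1 / sqrt s * v a) \<in> ball"
      using s by (simp add: ball_def power_divide sum_divide_distrib[symmetric] s_def[symmetric])
    from N1[OF this] have "\<bar>bilin d M v v\<bar> / s \<le> N"
      unfolding bilin_scale using s by (simp add: power_divide abs_mult)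
    then show ?thesis using s by (simp add: s_def[symmetric] field_simps)
  qed
  have "\<bar>bilin d M v v\<bar> \<le> \<tau> + 9 / 16 * N" if v: "v \<in> ball" for v
  proof -
    \<comment> \<open>Rounding moves each coordinate of \<open>c * v\<close> by at most 1, hence the
      vector by at most \<open>sqrt d\<close>, which is \<open>1 / 4\<close> after division by
      \<open>c\<close>. The factor 4 in \<open>u\<close> brings the remainder back into the unit
      ball.\<close>
    define c where "c = 4 * sqrt (real d)"
    have c: "c > 0" "c\<^sup>2 = 16 * real d" using d by (auto simp: c_def power_mult_distrib)
    have "\<forall>a. \<exists>k. \<bar>real_of_int k\<bar> \<le> \<bar>c * v a\<bar> \<and> \<bar>c * v a - real_of_int k\<bar> \<le> 1"
      by (intro allI ex_round_towards_zero)
    then obtain k0 where k0: "\<bar>real_of_int (k0 a)\<bar> \<le> \<bar>c * v a\<bar>" "\<bar>c * v a - real_of_int (k0 a)\<bar> \<le> 1" for a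
      unfolding choice_iff by blast
    define k where "k = restrict k0 {..<d}"
    define w where "w a = real_of_int (k a) / c" for a
    define u where "u a = 4 * (v a - w a)" for a
    have k1: "\<bar>real_of_int (k a)\<bar> \<le> c * \<bar>v a\<bar>" if "a < d" for a
      using k0(1)[of a] that c(1) by (simp add: k_def abs_mult)
    have k2: "\<bar>c * v a - real_of_int (k a)\<bar> \<le> 1" if "a < d" for a
      using k0(2)[of a] that by (simp add: k_def)
    have ksum: "(\<Sum>a<d. (real_of_int (k a))\<^sup>2) \<le> c\<^sup>2"
    proof -
      have "(\<Sum>a<d. (real_of_int (k a))\<^sup>2) \<le> (\<Sum>a<d. (c * \<bar>v a\<bar>)\<^sup>2)"
        by (intro sum_mono) (use k1 c in \<open>auto simp: abs_le_square_iff[symmetric] abs_mult\<close>)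
      also have "\<dots> = c\<^sup>2 * (\<Sum>a<d. (v a)\<^sup>2)" by (simp add: power_mult_distrib sum_distrib_left)
      also have "\<dots> \<le> c\<^sup>2" using v by (simp add: ball_def mult_left_le)
      finally show ?thesis .
    qed
    have "real_of_int (\<Sum>a<d. (k a)\<^sup>2) \<le> real_of_int (16 * int d)" using ksum c by simp
    then have kn: "k \<in> integer_net d"
      unfolding of_int_le_iff by (auto simp: integer_net_def k_def)
    have wk: "w = (\<lambda>a. 1 / c * real_of_int (k a))" by (simp add: w_def fun_eq_iff)
    have wb: "(\<Sum>a<d. (w a)\<^sup>2) \<le> 1"
      using ksum c d by (simp add: w_def power_divide sum_divide_distrib[symmetric])
    have "\<bar>bilin d M w w\<bar> \<le> (1 / c)\<^sup>2 * (\<tau> * (\<Sum>a<d. (real_of_int (k a))\<^sup>2))"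
      unfolding wk bilin_scale abs_mult using net[OF kn] by (intro mult_mono) auto
    also have "\<dots> = \<tau> * (\<Sum>a<d. (w a)\<^sup>2)"
      by (simp add: w_def power_divide sum_divide_distrib[symmetric])
    also have "\<dots> \<le> \<tau>" using wb \<tau> by (simp add: mult_left_le)
    finally have bw: "\<bar>bilin d M w w\<bar> \<le> \<tau>" .
    have ub: "(\<Sum>a<d. (u a)\<^sup>2) \<le> 1"
    proof -
      have "(\<Sum>a<d. (u a)\<^sup>2) \<le> (\<Sum>a<d. 16 / c\<^sup>2)"
      proof (rule sum_mono)
        fix a assume a: "a \<in> {..<d}"
        have "(u a)\<^sup>2 = 16 * (c * v a - real_of_int (k a))\<^sup>2 / c\<^sup>2"
          using c by (simp add: u_def w_def power2_eq_square field_simps)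
        also have "\<dots> \<le> 16 * 1 / c\<^sup>2"
          using k2[of a] a by (intro divide_right_mono mult_left_mono) (auto simp: abs_square_le_1)
        finally show "(u a)\<^sup>2 \<le> 16 / c\<^sup>2" by simp
      qed
      also have "\<dots> = 1" using c d by simp
      finally show ?thesis .
    qed
    have vu: "v = (\<lambda>a. w a + 1 / 4 * u a)" by (simp add: u_def fun_eq_iff field_simps)
    have s: "bilin d M u w = bilin d M w u"
      unfolding bilin_def by (subst sum.swap) (intro sum.cong refl; use sym in \<open>simp add: mult_ac\<close>)
    have e1: "bilin d M v v = bilin d M w w + bilin d M w u / 2 + bilin d M u u / 16"
      unfolding vu bilin_add_scale_left bilin_add_scale_right s by (simp add: field_simps)
    \<comment> \<open>Polarization reduces the mixed term to diagonal values; with the parallelogram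
      identity it is at most \<open>N\<close>. The terms involving \<open>u\<close> are then at most
      \<open>N / 2 + N / 16\<close>, which is the \<open>9 / 16\<close> above.\<close>
    have e2: "4 * bilin d M w u = bilin d M (\<lambda>a. w a + 1 * u a) (\<lambda>a. w a + 1 * u a)
        - bilin d M (\<lambda>a. w a + (- 1) * u a) (\<lambda>a. w a + (- 1) * u a)"
      unfolding bilin_add_scale_left bilin_add_scale_right s by simp
    have "\<bar>4 * bilin d M w u\<bar> \<le> N * (\<Sum>a<d. (w a + 1 * u a)\<^sup>2) + N * (\<Sum>a<d. (w a + (- 1) * u a)\<^sup>2)"
      unfolding e2 using N[of "\<lambda>a. w a + 1 * u a"] N[of "\<lambda>a. w a + (- 1) * u a"] by linarith
    also have "\<dots> = N * (2 * (\<Sum>a<d. (w a)\<^sup>2) + 2 * (\<Sum>a<d. (u a)\<^sup>2))"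
      by (simp add: power2_sum power2_diff sum.distrib sum_subtractf sum_distrib_left algebra_simps)
    also have "\<dots> \<le> N * 4"
    proof (rule mult_left_mono)
      show "0 \<le> N" using N1[OF v] by linarith
    qed (use wb ub in linarith)
    finally have b: "\<bar>bilin d M w u\<bar> \<le> N" by simp
    have "u \<in> ball" using ub by (simp add: ball_def)
    from N1[OF this] show ?thesis using bw b unfolding e1 by linarith
  qed
  then have "N \<le> \<tau> + 9 / 16 * N"
    unfolding N_def[symmetric] by (subst (1) N_def) (intro cSup_least; use ne in auto)
  then have "N \<le> 4 * \<tau>" using \<tau> by linarith
  have "\<bar>bilin d M v v\<bar> \<le> N * (\<Sum>a<d. (v a)\<^sup>2)" by (rule N)
  also have "\<dots> \<le> 4 * \<tau> * (\<Sum>a<d. (v a)\<^sup>2)"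
    by (intro mult_right_mono \<open>N \<le> 4 * \<tau>\<close> sum_nonneg) simp
  finally show ?thesis .
qed

section \<open>The certificate as a deterministic condition\<close>

text \<open>In matrix form \<open>Q = P (D + y\<^sub>T I) P\<close> for the projection \<open>P\<close> onto the vectors of mean zero.\<close>

lemma cert_Q_quadratic_form:
  fixes v :: "nat \<Rightarrow> real"
  assumes S: "finite S" "S \<noteq> {}" and sym: "\<And>a b. D a b = D b a"
  defines "u \<equiv> \<lambda>a. v a - (\<Sum>b\<in>S. v b) / real (card S)"
  shows "(\<Sum>a\<in>S. \<Sum>b\<in>S. v a * cert_Q D yT S a b * v b)
    = (\<Sum>a\<in>S. \<Sum>b\<in>S. u a * D a b * u b) + yT * (\<Sum>a\<in>S. (u a)\<^sup>2)"
proof -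
  define s where "s = real (card S)"
  define V where "V = (\<Sum>b\<in>S. v b)"
  define r where "r a = (\<Sum>b\<in>S. D a b)" for a
  define T where "T = (\<Sum>a\<in>S. r a)"
  define W where "W = (\<Sum>a\<in>S. v a * r a)"
  define B where "B = (\<Sum>a\<in>S. \<Sum>b\<in>S. v a * D a b * v b)"
  define N where "N = (\<Sum>a\<in>S. (v a)\<^sup>2)"
  define m where "m = V / s"
  have s: "s > 0" using S by (simp add: s_def card_gt_0_iff)
  have y: "cert_y D yT S a = (T / (2 * s\<^sup>2) - yT / (2 * s)) - r a / s" for a
    by (simp add: cert_y_def T_def r_def s_def)
  have yv: "(\<Sum>a\<in>S. v a * cert_y D yT S a) = (T / (2 * s\<^sup>2) - yT / (2 * s)) * V - W / s"
  proof -
    have "(\<Sum>a\<in>S. v a * (k - r a / s)) = k * V - W / s" for k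
      by (simp add: right_diff_distrib sum_subtractf V_def W_def sum_distrib_left sum_divide_distrib mult.commute)
    then show ?thesis unfolding y .
  qed
  have d: "(\<Sum>b\<in>S. v a * (if a = b then yT else 0) * v b) = yT * (v a)\<^sup>2" if "a \<in> S" for a
  proof -
    have "(\<Sum>b\<in>S. v a * (if a = b then yT else 0) * v b) = (\<Sum>b\<in>S. if a = b then yT * (v a)\<^sup>2 else 0)"
      by (intro sum.cong) (auto simp: power2_eq_square)
    then show ?thesis using that S by simp
  qed
  have "(\<Sum>a\<in>S. \<Sum>b\<in>S. v a * cert_Q D yT S a b * v b)
      = (\<Sum>a\<in>S. \<Sum>b\<in>S. v a * D a b * v b + (v a * cert_y D yT S a) * v b
          + v a * (v b * cert_y D yT S b) + v a * (if a = b then yT else 0) * v b)"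
    by (intro sum.cong refl) (simp add: cert_Q_def algebra_simps)
  also have "\<dots> = B + 2 * V * (\<Sum>a\<in>S. v a * cert_y D yT S a) + yT * N"
  proof -
    have "(\<Sum>a\<in>S. \<Sum>b\<in>S. (v a * cert_y D yT S a) * v b) = (\<Sum>a\<in>S. v a * cert_y D yT S a) * V"
      and "(\<Sum>a\<in>S. \<Sum>b\<in>S. v a * (v b * cert_y D yT S b)) = V * (\<Sum>a\<in>S. v a * cert_y D yT S a)"
      unfolding V_def by (rule sum_product[symmetric])+
    moreover have "(\<Sum>a\<in>S. \<Sum>b\<in>S. v a * (if a = b then yT else 0) * v b) = yT * N"
      by (simp add: d N_def sum_distrib_left cong: sum.cong)
    ultimately show ?thesis unfolding sum.distrib B_def by simp
  qed
  also have "\<dots> = B + 2 * V * ((T / (2 * s\<^sup>2) - yT / (2 * s)) * V - W / s) + yT * N"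
    unfolding yv ..
  \<comment> \<open>With \<open>m\<close> the mean of \<open>v\<close>, the part of
    \<open>cert_y\<close> containing \<open>yT\<close> contributes
    \<open>- yT * s * m\<^sup>2\<close>, exactly the loss in squared norm when \<open>v\<close> is
    centred.\<close>
  also have "\<dots> = (B - 2 * m * W + m\<^sup>2 * T) + yT * (N - s * m\<^sup>2)"
    using s by (simp add: m_def field_simps power2_eq_square)
  also have "B - 2 * m * W + m\<^sup>2 * T = (\<Sum>a\<in>S. \<Sum>b\<in>S. u a * D a b * u b)"
  proof -
    have col: "(\<Sum>b\<in>S. v b * (\<Sum>a\<in>S. D a b)) = W"
      unfolding W_def r_def by (intro sum.cong refl arg_cong2[where f="(*)"]) (rule sym)
    have "(\<Sum>a\<in>S. \<Sum>b\<in>S. u a * D a b * u b)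
        = (\<Sum>a\<in>S. \<Sum>b\<in>S. v a * D a b * v b - m * (v a * D a b) - m * (D a b * v b) + m\<^sup>2 * D a b)"
      unfolding u_def V_def[symmetric] s_def[symmetric] m_def[symmetric]
      by (intro sum.cong refl) (simp add: algebra_simps power2_eq_square)
    also have "\<dots> = B - m * W - m * (\<Sum>a\<in>S. \<Sum>b\<in>S. D a b * v b) + m\<^sup>2 * T"
      by (simp add: sum.distrib sum_subtractf sum_distrib_left[symmetric] B_def W_def T_def r_def)
    also have "(\<Sum>a\<in>S. \<Sum>b\<in>S. D a b * v b) = W"
      unfolding col[symmetric] by (subst sum.swap) (simp add: sum_distrib_left mult.commute)
    finally show ?thesis by simp
  qed
  also have "N - s * m\<^sup>2 = (\<Sum>a\<in>S. (u a)\<^sup>2)"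
  proof -
    have "(\<Sum>a\<in>S. (u a)\<^sup>2) = N - 2 * m * V + s * m\<^sup>2"
      unfolding u_def V_def[symmetric] s_def[symmetric] m_def[symmetric]
      by (simp add: power2_diff sum.distrib sum_subtractf N_def s_def V_def sum_distrib_left
          sum_distrib_right mult_ac)
    also have "m * V = s * m\<^sup>2" using s by (simp add: m_def power2_eq_square)
    then have "N - 2 * m * V + s * m\<^sup>2 = N - s * m\<^sup>2" by (simp add: mult.assoc)
    finally show ?thesis by simp
  qed
  finally show ?thesis .
qed

text \<open>If \<open>D\<close> is constantly \<open>- c\<close> on the block, the block average
  contributes \<open>- c / 2\<close> and the row mean \<open>c\<close>, together
  \<open>c / 2\<close>. A perturbation of size \<open>e\<close> costs \<open>e / 2\<close> in the
  former and \<open>e\<close> in the latter.\<close>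

lemma cert_y_const_lower:
  fixes e c :: real
  assumes S: "finite S" "S \<noteq> {}" and a: "a \<in> S"
    and D: "\<And>b b'. b \<in> S \<Longrightarrow> b' \<in> S \<Longrightarrow> \<bar>D b b' + c\<bar> \<le> e"
  shows "cert_y D yT S a \<ge> c / 2 - yT / (2 * real (card S)) - 3 / 2 * e"
proof -
  define s where "s = real (card S)"
  have s: "s > 0" using S by (simp add: s_def card_gt_0_iff)
  have "(\<Sum>b\<in>S. \<Sum>b'\<in>S. D b b') \<ge> (\<Sum>b\<in>S. \<Sum>b'\<in>S. - c - e)"
    by (intro sum_mono) (use D in \<open>force simp: abs_le_iff\<close>)
  then have "(\<Sum>b\<in>S. \<Sum>b'\<in>S. D b b') \<ge> s\<^sup>2 * (- c - e)"
    by (simp add: s_def power2_eq_square mult.assoc)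
  then have "(\<Sum>b\<in>S. \<Sum>b'\<in>S. D b b') / (2 * s\<^sup>2) \<ge> s\<^sup>2 * (- c - e) / (2 * s\<^sup>2)"
    by (rule divide_right_mono) simp
  moreover have "s\<^sup>2 * (- c - e) / (2 * s\<^sup>2) = (- c - e) / 2" using s by simp
  moreover have "(\<Sum>b\<in>S. D a b) / s \<le> - c + e"
  proof -
    have "(\<Sum>b\<in>S. D a b) \<le> (\<Sum>b\<in>S. - c + e)"
      by (intro sum_mono) (use D a in \<open>force simp: abs_le_iff\<close>)
    then show ?thesis using s by (simp add: s_def field_simps)
  qed
  ultimately have "cert_y D yT S a \<ge> (- c - e) / 2 - (- c + e) - yT / (2 * s)"
    unfolding cert_y_def s_def[symmetric] by linarith
  moreover have "(- c - e) / 2 - (- c + e) - z = c / 2 - z - 3 / 2 * e" for z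
    by (simp add: field_simps)
  ultimately show ?thesis by (simp add: s_def)
qed

text \<open>Between groups, the entry of \<open>D\<close> costs \<open>e\<close>, and each of the
  two \<open>cert_y\<close> terms costs \<open>3 / 2 * e\<close> and half of \<open>yT / m\<close>.
  This leaves half the separation minus \<open>4 * e + yT / m\<close>; doubling gives
  \<open>sep\<close>. Within groups, only mean-zero vectors have to be tested because the form of
  \<open>cert_Q\<close> centres its argument.\<close>

lemma force_certificateI:
  fixes e yT m :: real
  assumes G: "\<And>i. i < K \<Longrightarrow> finite (G i)" "\<And>i. i < K \<Longrightarrow> m \<le> real (card (G i))"
    and m: "m > 0" and yT: "yT \<ge> 0" and sym: "\<And>a b. D a b = D b a"
    and psd: "\<And>i v. i < K \<Longrightarrow> (\<Sum>a\<in>G i. v a) = 0 \<Longrightarrow>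
      (\<Sum>a\<in>G i. \<Sum>b\<in>G i. v a * D a b * v b) + yT * (\<Sum>a\<in>G i. (v a)\<^sup>2) \<ge> 0"
    and close: "\<And>i j a b. i < K \<Longrightarrow> j < K \<Longrightarrow> a \<in> G i \<Longrightarrow> b \<in> G j \<Longrightarrow> \<bar>D a b + C i j\<bar> \<le> e"
    and sep: "\<And>i j. i < K \<Longrightarrow> j < K \<Longrightarrow> i \<noteq> j \<Longrightarrow> C i i + C j j - 2 * C i j \<ge> 8 * e + 2 * (yT / m)"
  shows "force_certificate K G D"
  unfolding force_certificate_def
proof (intro exI[of _ yT] conjI allI impI ballI yT)
  have ne: "G i \<noteq> {}" if "i < K" for i using G(2)[OF that] m by auto
  fix i assume i: "i < K"
  show "psd_on (G i) (cert_Q D yT (G i))"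
    unfolding psd_on_def
  proof
    fix v :: "nat \<Rightarrow> real"
    show "0 \<le> (\<Sum>a\<in>G i. \<Sum>b\<in>G i. v a * cert_Q D yT (G i) a b * v b)"
      unfolding cert_Q_quadratic_form[OF G(1)[OF i] ne[OF i] sym]
      by (rule psd[OF i]) (use G(1)[OF i] ne[OF i] in \<open>simp add: sum_subtractf\<close>)
  qed
next
  have ne: "G i \<noteq> {}" if "i < K" for i using G(2)[OF that] m by auto
  fix i j a b assume i: "i < K" and j: "j < K" and ij: "i \<noteq> j" and a: "a \<in> G i" and b: "b \<in> G j"
  have y: "cert_y D yT (G k) x \<ge> C k k / 2 - (yT / m) / 2 - 3 / 2 * e" if k: "k < K" and x: "x \<in> G k" for k x
  proof -
    have "cert_y D yT (G k) x \<ge> C k k / 2 - yT / (2 * real (card (G k))) - 3 / 2 * e"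
      by (rule cert_y_const_lower[OF G(1)[OF k] ne[OF k] x close[OF k k]])
    moreover have "yT / (2 * real (card (G k))) \<le> yT / (2 * m)"
      using G(2)[OF k] m yT by (intro divide_left_mono) auto
    ultimately show ?thesis by simp
  qed
  show "0 \<le> D a b + cert_y D yT (G i) a + cert_y D yT (G j) b"
    using y[OF i a] y[OF j b] close[OF i j a b] sep[OF i j ij] by linarith
qed

section \<open>Sample covariances of the latent model\<close>

text \<open>The empirical second moment of a linear functional of the driving normals. Noise forms
  and, by polarization, covariance entries are both expressed through it, so a single tail bound
  serves both.\<close>

definition sample_quad :: "nat \<Rightarrow> nat \<Rightarrow> (nat \<times> nat \<Rightarrow> real) \<Rightarrow> (nat \<Rightarrow> real) \<Rightarrow> real" where
  "sample_quad n R w u = (1 / real n) * (\<Sum>l<n. (\<Sum>r<R. u r * w (l, r))\<^sup>2)"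

lemma (in prob_space) prob_Int_ge:
  assumes "A \<in> events" "B \<in> events"
  shows "prob (A \<inter> B) \<ge> prob A + prob B - 1"
proof -
  have "prob (A \<union> B) = prob A + prob B - prob (A \<inter> B)"
    using assms by (intro measure_Un3) (auto simp: fmeasurable_eq_sets)
  then show ?thesis using prob_le_1[of "A \<union> B"] by linarith
qed

text \<open>Union bound over the exceptional events. It is applied once to the directions of the net
  and once to signed pairs of variables.\<close>

lemma uniform_sample_quad_event:
  fixes u :: "'i \<Rightarrow> nat \<Rightarrow> real" and n R :: nat and t :: real
  assumes I: "finite I" and n: "n > 0" and t: "t \<ge> 0"
  defines "M \<equiv> PiM ({..<n} \<times> {..<R}) (\<lambda>_. density lborel std_normal_density)"
  obtains A where "A \<in> sets M"
    and "measure M A \<ge> 1 - real (card I) * (2 * exp (- real n * min t (t\<^sup>2) / 8))"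
    and "\<And>w i. w \<in> A \<Longrightarrow> i \<in> I \<Longrightarrow>
      \<bar>sample_quad n R w (u i) - (\<Sum>r<R. (u i r)\<^sup>2)\<bar> \<le> (\<Sum>r<R. (u i r)\<^sup>2) * t"
proof -
  interpret prob_space M unfolding M_def by (rule prob_space_std_normal_PiM)
  define E where "E i = {w \<in> space M. \<bar>(1 / real (card {..<n})) * (\<Sum>l<n. (\<Sum>r<R. u i r * w (l, r))\<^sup>2)
      - (\<Sum>r<R. (u i r)\<^sup>2)\<bar> > (\<Sum>r<R. (u i r)\<^sup>2) * t}" for i
  have L: "finite {..<n}" "{..<n} \<noteq> {}" using n by auto
  have E: "E i \<in> events" "prob (E i) \<le> 2 * exp (- real n * min t (t\<^sup>2) / 8)" for i
    using std_normal_PiM_quadratic_tail[OF L finite_lessThan t meta_eq_to_obj_eq[OF M_def] E_def[of i]] by simp_all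
  define B where "B = (\<Union>i\<in>I. E i)"
  have B: "B \<in> events" using I E by (auto simp: B_def)
  have "prob B \<le> (\<Sum>i\<in>I. prob (E i))"
    unfolding B_def using I E by (intro measure_UNION_le) auto
  also have "\<dots> \<le> (\<Sum>i\<in>I. 2 * exp (- real n * min t (t\<^sup>2) / 8))" by (intro sum_mono E)
  finally have pB: "prob B \<le> real (card I) * (2 * exp (- real n * min t (t\<^sup>2) / 8))" by simp
  show ?thesis
  proof (rule that[of "space M - B"])
    show "space M - B \<in> events" using B by auto
    show "prob (space M - B) \<ge> 1 - real (card I) * (2 * exp (- real n * min t (t\<^sup>2) / 8))"
      using prob_compl[OF B] pB by linarith
    fix w i assume "w \<in> space M - B" "i \<in> I"
    then show "\<bar>sample_quad n R w (u i) - (\<Sum>r<R. (u i r)\<^sup>2)\<bar> \<le> (\<Sum>r<R. (u i r)\<^sup>2) * t"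
      by (force simp: B_def E_def sample_quad_def)
  qed
qed

lemma sum_lessThan_add: "(\<Sum>r<K + d. f r) = (\<Sum>r<K. f r) + (\<Sum>j<d. f (K + j))"
  for f :: "nat \<Rightarrow> 'a :: comm_monoid_add"
  by (induction d) (auto simp: add_ac)

text \<open>The coordinates of the \<open>j\<close>-th variable in the driving normals; inner
  products of these vectors are population covariances.\<close>

definition data_coeff :: "nat \<Rightarrow> (nat \<Rightarrow> nat set) \<Rightarrow> (nat \<Rightarrow> nat \<Rightarrow> real) \<Rightarrow> (nat \<Rightarrow> real) \<Rightarrow> nat \<Rightarrow> nat \<Rightarrow> real" where
  "data_coeff K G L \<gamma> j r = (if r < K then (\<Sum>k<K. if j \<in> G k then L k r else 0)
     else if r = K + j then sqrt (\<gamma> j) else 0)"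

text \<open>The coordinates of the combination of noise variables with weights \<open>v\<close>; the
  latent coordinates \<open>r < K\<close> are zero.\<close>

definition noise_coeff :: "nat \<Rightarrow> (nat \<Rightarrow> real) \<Rightarrow> (nat \<Rightarrow> real) \<Rightarrow> nat \<Rightarrow> real" where
  "noise_coeff K \<gamma> v r = (if r < K then 0 else v (r - K) * sqrt (\<gamma> (r - K)))"

lemma glatent_data_eq:
  assumes "l < n" "j < d"
  shows "glatent_data n d K G L \<gamma> w l j = (\<Sum>r<K + d. data_coeff K G L \<gamma> j r * w (l, r))"
proof -
  have "(\<Sum>k<K. if j \<in> G k then (\<Sum>r<K. L k r * w (l, r)) else 0)
      = (\<Sum>k<K. \<Sum>r<K. (if j \<in> G k then L k r else 0) * w (l, r))"
    by (intro sum.cong) auto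
  also have "\<dots> = (\<Sum>r<K. (\<Sum>k<K. if j \<in> G k then L k r else 0) * w (l, r))"
    by (subst sum.swap) (simp add: sum_distrib_right)
  finally have 1: "(\<Sum>k<K. if j \<in> G k then (\<Sum>r<K. L k r * w (l, r)) else 0)
      = (\<Sum>r<K. data_coeff K G L \<gamma> j r * w (l, r))"
    by (simp add: data_coeff_def)
  have "(\<Sum>i<d. data_coeff K G L \<gamma> j (K + i) * w (l, K + i)) = (\<Sum>i<d. if i = j then sqrt (\<gamma> j) * w (l, K + j) else 0)"
    by (intro sum.cong) (auto simp: data_coeff_def)
  also have "\<dots> = sqrt (\<gamma> j) * w (l, K + j)" using assms by simp
  finally show ?thesis using assms by (simp add: glatent_data_def 1 sum_lessThan_add)
qed

lemma noise_coeff_sum: "(\<Sum>r<K + d. noise_coeff K \<gamma> v r * w (l, r)) = (\<Sum>a<d. v a * sqrt (\<gamma> a) * w (l, K + a))"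
  by (simp add: sum_lessThan_add noise_coeff_def)

lemma noise_coeff_norm:
  assumes "\<And>j. j < d \<Longrightarrow> \<gamma> j \<ge> 0"
  shows "(\<Sum>r<K + d. (noise_coeff K \<gamma> v r)\<^sup>2) = (\<Sum>a<d. (v a)\<^sup>2 * \<gamma> a)"
  using assms by (simp add: sum_lessThan_add noise_coeff_def power_mult_distrib)

section \<open>Covariance entries and noise forms for a fixed model\<close>

context
  fixes d K :: nat and G :: "nat \<Rightarrow> nat set" and L :: "nat \<Rightarrow> nat \<Rightarrow> real" and \<gamma> :: "nat \<Rightarrow> real"
  assumes model: "glatent_model d K G \<gamma>"
begin

lemma group_lt: "i < K \<Longrightarrow> a \<in> G i \<Longrightarrow> a < d"
  using model by (auto simp: glatent_model_def)

lemma finite_group: "i < K \<Longrightarrow> finite (G i)"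
  using model finite_subset[of "G i" "{..<d}"] by (auto simp: glatent_model_def)

lemma noise_var_nonneg: "j < d \<Longrightarrow> \<gamma> j \<ge> 0"
  using model by (auto simp: glatent_model_def)

lemma group_sum_unique:
  assumes "i < K" "a \<in> G i"
  shows "(\<Sum>k<K. if a \<in> G k then f k else 0) = (f i :: real)"
proof -
  have "a \<notin> G k" if "k < K" "k \<noteq> i" for k
    using model assms that unfolding glatent_model_def by blast
  then have "(\<Sum>k<K. if a \<in> G k then f k else 0) = (\<Sum>k<K. if k = i then f i else 0)"
    using assms by (intro sum.cong refl) auto
  then show ?thesis using assms by simp
qed

text \<open>The latent coordinates yield \<open>cov_of\<close>; the private noise coordinates
  \<open>K + a\<close> and \<open>K + b\<close> overlap only for \<open>a = b\<close>.\<close>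

lemma data_coeff_inner:
  assumes i: "i < K" "a \<in> G i" and j: "j < K" "b \<in> G j"
  shows "(\<Sum>r<K + d. data_coeff K G L \<gamma> a r * data_coeff K G L \<gamma> b r)
    = cov_of K L i j + (if a = b then \<gamma> a else 0)"
proof -
  have "(\<Sum>c<d. data_coeff K G L \<gamma> a (K + c) * data_coeff K G L \<gamma> b (K + c))
      = (\<Sum>c<d. if c = a then (if a = b then sqrt (\<gamma> a) * sqrt (\<gamma> a) else 0) else 0)"
    by (intro sum.cong) (auto simp: data_coeff_def)
  also have "\<dots> = (if a = b then \<gamma> a else 0)"
    using group_lt[OF i] noise_var_nonneg by simp
  finally show ?thesis
    by (simp add: sum_lessThan_add cov_of_def data_coeff_def group_sum_unique[OF i] group_sum_unique[OF j])
qed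

text \<open>Polarization: four times the empirical covariance is the second moment of the sum minus
  that of the difference. The two population norms add up to twice the sum of the variances, at most
  \<open>4 * \<sigma>\<close>, so the relative errors become \<open>\<sigma> * t\<close>.\<close>

lemma emp_cov_close:
  assumes i: "i < K" "a \<in> G i" and j: "j < K" "b \<in> G j"
    and \<sigma>: "cov_of K L i i + \<gamma> a \<le> \<sigma>" "cov_of K L j j + \<gamma> b \<le> \<sigma>" and t: "t \<ge> 0"
    and q: "\<And>s. s \<in> {1, -1} \<Longrightarrow>
      \<bar>sample_quad n (K + d) w (\<lambda>r. data_coeff K G L \<gamma> a r + s * data_coeff K G L \<gamma> b r)
        - (\<Sum>r<K + d. (data_coeff K G L \<gamma> a r + s * data_coeff K G L \<gamma> b r)\<^sup>2)\<bar>
      \<le> (\<Sum>r<K + d. (data_coeff K G L \<gamma> a r + s * data_coeff K G L \<gamma> b r)\<^sup>2) * t"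
  shows "\<bar>emp_cov n (glatent_data n d K G L \<gamma> w) a b - (cov_of K L i j + (if a = b then \<gamma> a else 0))\<bar> \<le> \<sigma> * t"
proof -
  let ?x = "data_coeff K G L \<gamma>"
  let ?X = "glatent_data n d K G L \<gamma> w"
  note ad = group_lt[OF i] and bd = group_lt[OF j]
  define N where "N s = (\<Sum>r<K + d. (?x a r + s * ?x b r)\<^sup>2)" for s
  define P where "P s = sample_quad n (K + d) w (\<lambda>r. ?x a r + s * ?x b r)" for s
  have Ns: "N s = (cov_of K L i i + \<gamma> a) + 2 * s * (cov_of K L i j + (if a = b then \<gamma> a else 0)) + s\<^sup>2 * (cov_of K L j j + \<gamma> b)" for s
  proof -
    have "N s = (\<Sum>r<K + d. ?x a r * ?x a r) + 2 * s * (\<Sum>r<K + d. ?x a r * ?x b r) + s\<^sup>2 * (\<Sum>r<K + d. ?x b r * ?x b r)"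
      unfolding N_def sum_distrib_left sum.distrib[symmetric]
      by (intro sum.cong refl) (simp add: power2_eq_square algebra_simps)
    then show ?thesis
      unfolding data_coeff_inner[OF i i] data_coeff_inner[OF i j] data_coeff_inner[OF j j] by simp
  qed
  have Ps: "P s = (1 / real n) * (\<Sum>l<n. (?X l a + s * ?X l b)\<^sup>2)" for s
    unfolding P_def sample_quad_def
    by (simp add: glatent_data_eq ad bd distrib_right sum.distrib sum_distrib_left mult.assoc)
  have "4 * emp_cov n ?X a b = P 1 - P (-1)"
    unfolding Ps emp_cov_def right_diff_distrib[symmetric] sum_subtractf[symmetric] sum_distrib_left
    by (intro sum.cong refl) (simp add: power2_eq_square algebra_simps)
  moreover have "\<bar>P 1 - N 1\<bar> \<le> N 1 * t" "\<bar>P (-1) - N (-1)\<bar> \<le> N (-1) * t"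
    unfolding P_def N_def by (rule q, simp)+
  moreover have "N 1 - N (-1) = 4 * (cov_of K L i j + (if a = b then \<gamma> a else 0))" by (simp add: Ns)
  moreover have "N 1 * t + N (-1) * t \<le> 4 * (\<sigma> * t)"
  proof -
    have "N 1 + N (-1) \<le> 4 * \<sigma>" using \<sigma> by (simp add: Ns)
    then have "(N 1 + N (-1)) * t \<le> 4 * \<sigma> * t" using t by (rule mult_right_mono)
    then show ?thesis by (simp add: distrib_right)
  qed
  moreover have "\<bar>E - c\<bar> \<le> y" if "4 * E = p - p'" "\<bar>p - m\<bar> \<le> x" "\<bar>p' - m'\<bar> \<le> x'" "m - m' = 4 * c" "x + x' \<le> 4 * y"
    for E p p' m m' x x' c y :: real
    using that by linarith
  ultimately show ?thesis by blast
qed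

text \<open>The matrix \<open>M\<close> is the empirical noise covariance minus its mean. On the net
  its form is at most \<open>t\<close> times a \<open>\<gamma>\<close>-weighted norm, hence at most
  \<open>\<Gamma> * t\<close> times the plain norm; the passage from the net to all vectors costs
  the factor 4.\<close>

lemma noise_form_bound:
  assumes d: "d > 0" and t: "t \<ge> 0" and \<Gamma>: "\<And>j. j < d \<Longrightarrow> \<gamma> j \<le> \<Gamma>"
    and net: "\<And>k. k \<in> integer_net d \<Longrightarrow>
      \<bar>sample_quad n (K + d) w (noise_coeff K \<gamma> (\<lambda>a. real_of_int (k a)))
        - (\<Sum>r<K + d. (noise_coeff K \<gamma> (\<lambda>a. real_of_int (k a)) r)\<^sup>2)\<bar>
      \<le> (\<Sum>r<K + d. (noise_coeff K \<gamma> (\<lambda>a. real_of_int (k a)) r)\<^sup>2) * t"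
  shows "\<bar>sample_quad n (K + d) w (noise_coeff K \<gamma> v) - (\<Sum>a<d. (v a)\<^sup>2 * \<gamma> a)\<bar> \<le> 4 * (\<Gamma> * t) * (\<Sum>a<d. (v a)\<^sup>2)"
proof -
  define e where "e l a = sqrt (\<gamma> a) * w (l, K + a)" for l a
  define M where "M a b = (1 / real n) * (\<Sum>l<n. e l a * e l b) - (if a = b then \<gamma> a else 0)" for a b
  have bil: "bilin d M v v = sample_quad n (K + d) w (noise_coeff K \<gamma> v) - (\<Sum>a<d. (v a)\<^sup>2 * \<gamma> a)" for v
  proof -
    have "(\<Sum>b<d. v a * (if a = b then \<gamma> a else 0) * v b) = (v a)\<^sup>2 * \<gamma> a" if "a < d" for a
    proof -
      have "(\<Sum>b<d. v a * (if a = b then \<gamma> a else 0) * v b) = (\<Sum>b<d. if b = a then (v a)\<^sup>2 * \<gamma> a else 0)"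
        by (intro sum.cong) (auto simp: power2_eq_square)
      then show ?thesis using that by simp
    qed
    then have 1: "(\<Sum>a<d. \<Sum>b<d. v a * (if a = b then \<gamma> a else 0) * v b) = (\<Sum>a<d. (v a)\<^sup>2 * \<gamma> a)"
      by simp
    have "sample_quad n (K + d) w (noise_coeff K \<gamma> v) = (1 / real n) * (\<Sum>l<n. (\<Sum>a<d. v a * e l a)\<^sup>2)"
      unfolding sample_quad_def noise_coeff_sum e_def by (simp add: mult.assoc)
    also have "\<dots> = (1 / real n) * (\<Sum>l<n. \<Sum>a<d. \<Sum>b<d. v a * (e l a * e l b) * v b)"
      unfolding power2_eq_square sum_product by (simp add: mult_ac)
    also have "(\<Sum>l<n. \<Sum>a<d. \<Sum>b<d. v a * (e l a * e l b) * v b) = (\<Sum>a<d. \<Sum>b<d. \<Sum>l<n. v a * (e l a * e l b) * v b)"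
      by (rule trans[OF sum.swap sum.cong[OF refl sum.swap]])
    also have "(1 / real n) * \<dots> = (\<Sum>a<d. \<Sum>b<d. v a * ((1 / real n) * (\<Sum>l<n. e l a * e l b)) * v b)"
      by (simp add: sum_distrib_left sum_distrib_right mult_ac)
    finally show ?thesis
      unfolding bilin_def M_def 1[symmetric] right_diff_distrib left_diff_distrib sum_subtractf by simp
  qed
  have sym: "M a b = M b a" for a b by (simp add: M_def mult.commute)
  have \<Gamma>0: "\<Gamma> \<ge> 0" using \<Gamma>[OF d] noise_var_nonneg[OF d] by linarith
  have "\<bar>bilin d M v v\<bar> \<le> 4 * (\<Gamma> * t) * (\<Sum>a<d. (v a)\<^sup>2)"
  proof (rule bilin_le_of_integer_net[OF d _ sym])
    show "0 \<le> \<Gamma> * t" using \<Gamma>0 t by simp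
    fix k assume k: "k \<in> integer_net d"
    let ?k = "\<lambda>a. real_of_int (k a)"
    have "\<bar>bilin d M ?k ?k\<bar> \<le> (\<Sum>a<d. (?k a)\<^sup>2 * \<gamma> a) * t"
      using net[OF k] by (simp only: bil noise_coeff_norm noise_var_nonneg)
    also have "\<dots> \<le> (\<Sum>a<d. (?k a)\<^sup>2 * \<Gamma>) * t"
      using t by (intro mult_right_mono sum_mono mult_left_mono \<Gamma>) auto
    finally show "\<bar>bilin d M ?k ?k\<bar> \<le> \<Gamma> * t * (\<Sum>a<d. (?k a)\<^sup>2)"
      by (simp add: sum_distrib_left[symmetric] mult_ac)
  qed
  then show ?thesis unfolding bil .
qed

text \<open>A contrast \<open>v\<close> within a group annihilates the latent factors, so only the noise is left.\<close>

lemma contrast_emp_cov: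
  assumes i: "i < K" and v: "(\<Sum>a\<in>G i. v a) = 0"
  shows "(\<Sum>a\<in>G i. \<Sum>b\<in>G i. v a * emp_cov n (glatent_data n d K G L \<gamma> w) a b * v b)
    = sample_quad n (K + d) w (noise_coeff K \<gamma> (\<lambda>a. if a \<in> G i then v a else 0))"
proof -
  let ?X = "glatent_data n d K G L \<gamma> w"
  have sub: "G i \<subseteq> {..<d}" using group_lt[OF i] by auto
  have X: "(\<Sum>a\<in>G i. v a * ?X l a) = (\<Sum>a<d. (if a \<in> G i then v a else 0) * sqrt (\<gamma> a) * w (l, K + a))" if l: "l < n" for l
  proof -
    define Z where "Z = (\<Sum>r<K. L i r * w (l, r))"
    have "(\<Sum>a\<in>G i. v a * ?X l a) = (\<Sum>a\<in>G i. v a * Z + v a * sqrt (\<gamma> a) * w (l, K + a))"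
      using l group_lt[OF i]
      by (intro sum.cong refl) (simp add: glatent_data_def group_sum_unique[OF i] Z_def distrib_left mult.assoc)
    also have "\<dots> = (\<Sum>a\<in>G i. v a * sqrt (\<gamma> a) * w (l, K + a))"
      by (simp add: sum.distrib sum_distrib_right[symmetric] v)
    also have "\<dots> = (\<Sum>a<d. (if a \<in> G i then v a else 0) * sqrt (\<gamma> a) * w (l, K + a))"
      by (rule sum.mono_neutral_cong_left) (use sub in auto)
    finally show ?thesis .
  qed
  have "(\<Sum>a\<in>G i. \<Sum>b\<in>G i. v a * emp_cov n ?X a b * v b)
      = (1 / real n) * (\<Sum>a\<in>G i. \<Sum>b\<in>G i. \<Sum>l<n. (v a * ?X l a) * (v b * ?X l b))"
    by (simp add: emp_cov_def sum_distrib_left sum_distrib_right mult_ac)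
  also have "(\<Sum>a\<in>G i. \<Sum>b\<in>G i. \<Sum>l<n. (v a * ?X l a) * (v b * ?X l b))
      = (\<Sum>l<n. \<Sum>a\<in>G i. \<Sum>b\<in>G i. (v a * ?X l a) * (v b * ?X l b))"
    by (rule trans[OF sum.cong[OF refl sum.swap] sum.swap])
  also have "\<dots> = (\<Sum>l<n. (\<Sum>a\<in>G i. v a * ?X l a)\<^sup>2)"
    by (simp add: power2_eq_square sum_product)
  finally show ?thesis
    unfolding sample_quad_def noise_coeff_sum by (simp add: X)
qed

end

section \<open>Probability of the good event\<close>

lemma diag_norm_ge: "j < d \<Longrightarrow> \<bar>\<gamma> j\<bar> \<le> diag_norm d \<gamma>"
  unfolding diag_norm_def by (rule Max_ge) auto

lemma min_size_le: "i < K \<Longrightarrow> min_size K G \<le> card (G i)"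
  unfolding min_size_def by (rule Min_le) auto

lemma cov_of_commute: "cov_of K L i j = cov_of K L j i"
  by (simp add: cov_of_def mult.commute)

text \<open>The minimum runs over \<open>j < k\<close> only; symmetry of \<open>C\<close> covers the
  other order.\<close>

lemma Delta_le:
  assumes sym: "\<And>i j. C i j = C j i" and "i < K" "j < K" "i \<noteq> j"
  shows "Delta K C \<le> C i i + C j j - 2 * C i j"
proof -
  have le: "Delta K C \<le> C i i + C j j - 2 * C i j" if "i < j" "j < K" for i j
  proof -
    have "{C j j + C k k - 2 * C j k |j k. j < k \<and> k < K}
        \<subseteq> (\<lambda>(j, k). C j j + C k k - 2 * C j k) ` ({..<K} \<times> {..<K})" by force
    then have "finite {C j j + C k k - 2 * C j k |j k. j < k \<and> k < K}"
      by (rule finite_subset) auto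
    then show ?thesis unfolding Delta_def using that by (intro Min_le) auto
  qed
  show ?thesis
    using le[of i j] le[of j i] assms(2-) sym[of i j] by (cases "i < j") auto
qed

section \<open>Tail sums with explicit constants\<close>

lemma min_square_ge:
  fixes t x c :: real
  assumes "c > 0" "x \<le> c * t" "x \<le> c * t\<^sup>2"
  shows "- c * min t (t\<^sup>2) / 8 \<le> - x / 8"
  using assms by (simp add: min_def)

text \<open>The term \<open>d / n\<close> in \<open>t\<close> handles the linear regime of the tail
  and \<open>sqrt (d / n)\<close> the quadratic one; in both the exponent is at least
  \<open>160 * d / 8 = 20 * d\<close>. Twice the size of the net is at most
  \<open>exp (19 * d)\<close>, which leaves \<open>exp (- d)\<close>, at most
  \<open>1 / d\<close>.\<close>

lemma integer_net_tail:
  fixes d n :: nat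
  assumes d: "d > 0" and n: "n > 0"
  defines "t \<equiv> 160 * (sqrt (real d / real n) + real d / real n)"
  shows "real (card (integer_net d)) * (2 * exp (- real n * min t (t\<^sup>2) / 8)) \<le> 1 / real d"
proof -
  define q where "q = real d / real n"
  have q: "q > 0" "real n * q = real d" using d n by (auto simp: q_def)
  have "real n * (160 * q) \<le> real n * t"
    using q by (intro mult_left_mono) (auto simp: t_def q_def[symmetric])
  then have 1: "160 * real d \<le> real n * t" using q by simp
  have "160 * q \<le> (160 * sqrt q)\<^sup>2" using q by (simp add: power_mult_distrib)
  also have "\<dots> \<le> t\<^sup>2"
    unfolding t_def q_def[symmetric] using q by (intro power_mono) auto
  finally have "real n * (160 * q) \<le> real n * t\<^sup>2" by (intro mult_left_mono) auto
  then have 2: "160 * real d \<le> real n * t\<^sup>2" using q by simp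
  have e: "exp (- real n * min t (t\<^sup>2) / 8) \<le> exp (- (20 * real d))"
    using min_square_ge[OF _ 1 2] n by simp
  have two: "2 * 2 ^ (18 * d) \<le> exp (1 :: real) ^ (19 * d)"
  proof -
    have "2 * 2 ^ (18 * d) = (2 :: real) ^ Suc (18 * d)" by simp
    also have "\<dots> \<le> 2 ^ (19 * d)" using d by (intro power_increasing) auto
    also have "\<dots> \<le> exp 1 ^ (19 * d)"
      using exp_ge_add_one_self[of "1 :: real"] by (intro power_mono) auto
    finally show ?thesis .
  qed
  have "real (card (integer_net d)) * (2 * exp (- real n * min t (t\<^sup>2) / 8))
      \<le> 2 ^ (18 * d) * (2 * exp (- (20 * real d)))"
    by (intro mult_mono card_integer_net e) auto
  also have "\<dots> \<le> exp 1 ^ (19 * d) * exp (- (20 * real d))"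
    using mult_right_mono[OF two, of "exp (- (20 * real d))"] by simp
  also have "\<dots> = exp (- real d)"
    by (simp add: exp_of_nat_mult[symmetric] mult_exp_exp)
  also have "\<dots> \<le> 1 / real d"
    proof -
    have "real d \<le> exp (real d)" using exp_ge_add_one_self[of "real d"] by linarith
    then show ?thesis unfolding exp_minus inverse_eq_divide using d by (intro frac_le) simp_all
  qed
  finally show ?thesis .
qed

text \<open>There are \<open>2 * d\<^sup>2\<close> signed pairs, and an exponent of
  \<open>24 * ln d / 8 = 3 * ln d\<close> makes each failure probability at most
  \<open>2 / d ^ 3\<close>. In the quadratic regime \<open>5\<^sup>2 \<ge> 24\<close> suffices; in
  the linear one \<open>ln d / n \<le> \<bar>p\<bar>\<close> turns
  \<open>24 * sqrt \<bar>p\<bar>\<close> into the required factor.\<close>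

lemma pairs_tail:
  fixes d n :: nat and p :: real
  assumes d: "d > 1" and n: "n > 0" and ln: "ln (real d) \<le> p * real n"
  defines "t \<equiv> (5 + 24 * sqrt \<bar>p\<bar>) * sqrt (ln (real d) / real n)"
  shows "real (card ({..<d} \<times> {..<d} \<times> {1, -1 :: real})) * (2 * exp (- real n * min t (t\<^sup>2) / 8)) \<le> 4 / real d"
proof -
  define q where "q = ln (real d) / real n"
  define k where "k = 5 + 24 * sqrt \<bar>p\<bar>"
  have q: "q > 0" "real n * q = ln (real d)" using d n by (auto simp: q_def)
  have qp: "q \<le> \<bar>p\<bar>" using ln n by (simp add: q_def divide_le_eq) (smt (verit) mult_right_mono of_nat_0_le_iff)
  have k: "k \<ge> 5" "k \<ge> 24 * sqrt q" using qp by (auto simp: k_def add_increasing)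
  have "24 * q = 24 * sqrt q * sqrt q" using q by simp
  also have "\<dots> \<le> k * sqrt q" using k q by (intro mult_right_mono) auto
  finally have "real n * (24 * q) \<le> real n * t"
    by (intro mult_left_mono) (auto simp: t_def q_def k_def)
  then have 1: "24 * ln (real d) \<le> real n * t" using q by simp
  have "24 * q \<le> 5\<^sup>2 * q" using q by simp
  also have "\<dots> \<le> k\<^sup>2 * q" using k q by (intro mult_right_mono power_mono) auto
  also have "\<dots> = t\<^sup>2" using q by (simp add: t_def q_def[symmetric] k_def[symmetric] power_mult_distrib)
  finally have "real n * (24 * q) \<le> real n * t\<^sup>2" by (intro mult_left_mono) auto
  then have 2: "24 * ln (real d) \<le> real n * t\<^sup>2" using q by simp
  have e: "exp (- real n * min t (t\<^sup>2) / 8) \<le> exp (- (3 * ln (real d)))"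
    using min_square_ge[OF _ 1 2] n by simp
  also have "\<dots> = 1 / real d ^ 3"
    using d by (simp add: exp_minus exp_of_nat_mult[of 3, simplified] inverse_eq_divide)
  finally have "real (card ({..<d} \<times> {..<d} \<times> {1, -1 :: real})) * (2 * exp (- real n * min t (t\<^sup>2) / 8))
      \<le> (2 * real d ^ 2) * (2 * (1 / real d ^ 3))"
    by (intro mult_mono) (auto simp: card_cartesian_product power2_eq_square)
  also have "\<dots> = 4 / real d" using d by (simp add: power2_eq_square power3_eq_cube)
  finally show ?thesis .
qed

text \<open>The deterministic half, for one fixed outcome \<open>w\<close>. On contrasts within a
  group the form of \<open>D\<close> is the estimation error of the diagonal minus the centred noise
  form, so it is at least \<open>- (4 * (\<Gamma> * t1) + \<delta>)\<close> times the squared norm.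
  Entrywise, \<open>D\<close> differs from \<open>- C\<close> by at most
  \<open>\<sigma> * t2 + \<delta>\<close>.\<close>

lemma certificate_on_good_event:
  fixes \<Gamma> \<sigma> \<delta> t1 t2 yT :: real
  assumes model: "glatent_model d K G \<gamma>" and d: "d > 0"
    and t1: "t1 \<ge> 0" and t2: "t2 \<ge> 0"
    and \<Gamma>: "\<And>j. j < d \<Longrightarrow> \<gamma> j \<le> \<Gamma>"
    and \<sigma>: "\<And>i. i < K \<Longrightarrow> cov_of K L i i + \<Gamma> \<le> \<sigma>"
    and net: "\<And>k. k \<in> integer_net d \<Longrightarrow>
      \<bar>sample_quad n (K + d) w (noise_coeff K \<gamma> (\<lambda>a. real_of_int (k a)))
        - (\<Sum>r<K + d. (noise_coeff K \<gamma> (\<lambda>a. real_of_int (k a)) r)\<^sup>2)\<bar>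
      \<le> (\<Sum>r<K + d. (noise_coeff K \<gamma> (\<lambda>a. real_of_int (k a)) r)\<^sup>2) * t1"
    and pairs: "\<And>a b s. a < d \<Longrightarrow> b < d \<Longrightarrow> s \<in> {1, -1} \<Longrightarrow>
      \<bar>sample_quad n (K + d) w (\<lambda>r. data_coeff K G L \<gamma> a r + s * data_coeff K G L \<gamma> b r)
        - (\<Sum>r<K + d. (data_coeff K G L \<gamma> a r + s * data_coeff K G L \<gamma> b r)\<^sup>2)\<bar>
      \<le> (\<Sum>r<K + d. (data_coeff K G L \<gamma> a r + s * data_coeff K G L \<gamma> b r)\<^sup>2) * t2"
    and gh: "\<And>j. j < d \<Longrightarrow> \<bar>gh j - \<gamma> j\<bar> \<le> \<delta>"
    and yT: "yT \<ge> 4 * (\<Gamma> * t1) + \<delta>"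
    and sep: "Delta K (cov_of K L) \<ge> 8 * (\<sigma> * t2 + \<delta>) + 2 * (yT / real (min_size K G))"
  shows "force_certificate K G
    (\<lambda>a b. (if a = b then gh a else 0) - emp_cov n (glatent_data n d K G L \<gamma> w) a b)"
proof (rule force_certificateI[where C = "cov_of K L" and e = "\<sigma> * t2 + \<delta>" and yT = yT])
  let ?X = "glatent_data n d K G L \<gamma> w"
  have \<Gamma>0: "\<Gamma> \<ge> 0" using \<Gamma>[OF d] noise_var_nonneg[OF model d] by linarith
  have \<delta>0: "\<delta> \<ge> 0" using gh[OF d] by linarith
  have Gt: "\<Gamma> * t1 \<ge> 0" using \<Gamma>0 t1 by simp
  show "yT \<ge> 0" using yT Gt \<delta>0 by linarith
  show "finite (G i)" if "i < K" for i using finite_group[OF model that] .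
  show "real (min_size K G) \<le> real (card (G i))" if "i < K" for i
    using min_size_le[OF that] by simp
  have K: "K \<ge> 1" using model by (simp add: glatent_model_def)
  \<comment> \<open>The minimum is attained by some group, and every group has at least three
    elements.\<close>
  have "min_size K G \<in> {card (G k) |k. k < K}"
    unfolding min_size_def using K by (intro Min_in) (auto intro: exI[of _ 0])
  then show "real (min_size K G) > 0" using model by (force simp: glatent_model_def)
  show "(if a = b then gh a else 0) - emp_cov n ?X a b = (if b = a then gh b else 0) - emp_cov n ?X b a" for a b
    by (auto simp: emp_cov_def mult.commute)
  show "8 * (\<sigma> * t2 + \<delta>) + 2 * (yT / real (min_size K G)) \<le> cov_of K L i i + cov_of K L j j - 2 * cov_of K L i j"
    if "i < K" "j < K" "i \<noteq> j" for i j
    using sep Delta_le[OF cov_of_commute that] by (rule order_trans)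
  show "\<bar>(if a = b then gh a else 0) - emp_cov n ?X a b + cov_of K L i j\<bar> \<le> \<sigma> * t2 + \<delta>"
    if i: "i < K" and j: "j < K" and a: "a \<in> G i" and b: "b \<in> G j" for i j a b
  proof -
    have ad: "a < d" "b < d" using group_lt[OF model] i j a b by auto
    have "\<bar>emp_cov n ?X a b - (cov_of K L i j + (if a = b then \<gamma> a else 0))\<bar> \<le> \<sigma> * t2"
      by (rule emp_cov_close[OF model i a j b _ _ t2 pairs[OF ad]])
        (use \<sigma>[OF i] \<sigma>[OF j] \<Gamma> ad in force)+
    then show ?thesis using gh[OF ad(1)] \<delta>0 by (auto simp: abs_le_iff)
  qed
  show "0 \<le> (\<Sum>a\<in>G i. \<Sum>b\<in>G i. v a * ((if a = b then gh a else 0) - emp_cov n ?X a b) * v b)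
      + yT * (\<Sum>a\<in>G i. (v a)\<^sup>2)" if i: "i < K" and v: "(\<Sum>a\<in>G i. v a) = 0" for i v
  proof -
    \<comment> \<open>Extension by zero: a single net in dimension \<open>d\<close> serves all
      groups at once.\<close>
    define u where "u a = (if a \<in> G i then v a else 0)" for a
    have sub: "G i \<subseteq> {..<d}" using group_lt[OF model i] by auto
    have u: "(\<Sum>a<d. (u a)\<^sup>2 * f a) = (\<Sum>a\<in>G i. (v a)\<^sup>2 * f a)" for f :: "nat \<Rightarrow> real"
      unfolding u_def by (rule sum.mono_neutral_cong_right) (use sub in auto)
    have u1: "(\<Sum>a<d. (u a)\<^sup>2) = (\<Sum>a\<in>G i. (v a)\<^sup>2)" using u[of "\<lambda>_. 1"] by simp
    have diag: "(\<Sum>b\<in>G i. v a * (if a = b then gh a else 0) * v b) = (v a)\<^sup>2 * gh a" if "a \<in> G i" for a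
    proof -
      have "(\<Sum>b\<in>G i. v a * (if a = b then gh a else 0) * v b) = (\<Sum>b\<in>G i. if b = a then (v a)\<^sup>2 * gh a else 0)"
        by (intro sum.cong) (auto simp: power2_eq_square)
      then show ?thesis using that finite_group[OF model i] by simp
    qed
    have "(\<Sum>a\<in>G i. \<Sum>b\<in>G i. v a * ((if a = b then gh a else 0) - emp_cov n ?X a b) * v b)
        = (\<Sum>a\<in>G i. \<Sum>b\<in>G i. v a * (if a = b then gh a else 0) * v b)
          - (\<Sum>a\<in>G i. \<Sum>b\<in>G i. v a * emp_cov n ?X a b * v b)"
      unfolding right_diff_distrib left_diff_distrib sum_subtractf ..
    also have "\<dots> = (\<Sum>a\<in>G i. (v a)\<^sup>2 * gh a) - sample_quad n (K + d) w (noise_coeff K \<gamma> u)"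
      unfolding contrast_emp_cov[OF model i v] by (simp add: diag u_def[abs_def])
    finally have eq: "(\<Sum>a\<in>G i. \<Sum>b\<in>G i. v a * ((if a = b then gh a else 0) - emp_cov n ?X a b) * v b)
        = (\<Sum>a\<in>G i. (v a)\<^sup>2 * gh a) - sample_quad n (K + d) w (noise_coeff K \<gamma> u)" .
    have "(\<Sum>a\<in>G i. (v a)\<^sup>2 * gh a) - sample_quad n (K + d) w (noise_coeff K \<gamma> u) \<ge> - (yT * (\<Sum>a\<in>G i. (v a)\<^sup>2))"
    proof -
      have 1: "sample_quad n (K + d) w (noise_coeff K \<gamma> u)
          \<le> (\<Sum>a\<in>G i. (v a)\<^sup>2 * \<gamma> a) + 4 * (\<Gamma> * t1) * (\<Sum>a\<in>G i. (v a)\<^sup>2)"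
        using noise_form_bound[OF model d t1 \<Gamma> net, of u] unfolding u u1 by linarith
      have "(\<Sum>a\<in>G i. (v a)\<^sup>2 * \<gamma> a) - \<delta> * (\<Sum>a\<in>G i. (v a)\<^sup>2) = (\<Sum>a\<in>G i. (v a)\<^sup>2 * (\<gamma> a - \<delta>))"
        by (simp add: sum_distrib_left sum_subtractf[symmetric] algebra_simps)
      also have "\<dots> \<le> (\<Sum>a\<in>G i. (v a)\<^sup>2 * gh a)"
        using gh group_lt[OF model i] by (intro sum_mono mult_left_mono) (force simp: abs_le_iff)+
      finally have 2: "(\<Sum>a\<in>G i. (v a)\<^sup>2 * \<gamma> a) - \<delta> * (\<Sum>a\<in>G i. (v a)\<^sup>2) \<le> (\<Sum>a\<in>G i. (v a)\<^sup>2 * gh a)" .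
      have "(4 * (\<Gamma> * t1) + \<delta>) * (\<Sum>a\<in>G i. (v a)\<^sup>2) \<le> yT * (\<Sum>a\<in>G i. (v a)\<^sup>2)"
        using yT by (intro mult_right_mono sum_nonneg) auto
      then show ?thesis using 1 2 unfolding distrib_right by linarith
    qed
    then show ?thesis unfolding eq by linarith
  qed
qed

section \<open>Choice of constants and union of the failure probabilities\<close>

theorem theorem4p1:
  fixes p0 p1 p2 :: real
    and Gh :: "nat \<Rightarrow> nat \<Rightarrow> (nat \<Rightarrow> nat \<Rightarrow> real) \<Rightarrow> nat \<Rightarrow> real"
  assumes "estimator_assumption p0 p1 p2 Gh"
  shows "\<exists>c1 c2 c3 :: real. c1 > 0 \<and> c2 > 0 \<and> c3 > 0 \<and>
    (\<forall>n d K G L \<gamma>.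
       glatent_model d K G \<gamma> \<and> K \<ge> 2 \<and>
       Delta K (cov_of K L) > 0 \<and>
       ln (real d) \<le> p0 * real n \<and>
       Delta K (cov_of K L) \<ge>
         c1 * diag_norm d \<gamma> *
           (sqrt (ln (real d) / (real n * real (min_size K G)))
            + sqrt (real d / (real n * real (min_size K G) ^ 2))
            + real d / (real n * real (min_size K G)))
         + c2 * (Max {cov_of K L i i | i. i < K} + diag_norm d \<gamma>) * sqrt (ln (real d) / real n)
     \<longrightarrow>
       (\<exists>A \<in> sets (glatent_space n K d).
          measure (glatent_space n K d) A \<ge> 1 - c3 / real d \<and>
          (\<forall>w \<in> A.
             force_certificate K G
               (\<lambda>a b. (if a = b then Gh n d (glatent_data n d K G L \<gamma> w) a else 0)
                      - emp_cov n (glatent_data n d K G L \<gamma> w) a b))))"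
proof -
  \<comment> \<open>All constants depend on \<open>p0\<close>, \<open>p1\<close>, \<open>p2\<close>
    only. In \<open>c\<close>, \<open>640 = 4 * 160\<close> is the net factor times the deviation
    constant and \<open>\<bar>p1\<bar>\<close> pays for the diagonal estimator. The factors 2 in
    \<open>c1\<close> and 8 in \<open>c2\<close> are those of the separation condition. In
    \<open>c3\<close>, the net accounts for 1, the pairs for 4 and the estimator for
    \<open>\<bar>p2\<bar>\<close>.\<close>
  define k where "k = 5 + 24 * sqrt \<bar>p0\<bar>"
  define c where "c = 640 + \<bar>p1\<bar>"
  define c1 where "c1 = 2 * c"
  define c2 where "c2 = 8 * (k + \<bar>p1\<bar>)"
  define c3 where "c3 = 5 + \<bar>p2\<bar>"
  have k: "k \<ge> 5" by (simp add: k_def)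
  have c: "c > 0" by (simp add: c_def)
  have pos: "c1 > 0" "c2 > 0" "c3 > 0" using k c by (auto simp: c1_def c2_def c3_def)
  show ?thesis
  proof (rule exI[of _ c1], rule exI[of _ c2], rule exI[of _ c3], intro conjI pos allI impI, elim conjE)
    fix n d K :: nat and G :: "nat \<Rightarrow> nat set" and L :: "nat \<Rightarrow> nat \<Rightarrow> real" and \<gamma> :: "nat \<Rightarrow> real"
    define m where "m = real (min_size K G)"
    define \<Gamma> where "\<Gamma> = diag_norm d \<gamma>"
    define \<sigma> where "\<sigma> = Max {cov_of K L i i | i. i < K} + \<Gamma>"
    define sl where "sl = sqrt (ln (real d) / real n)"
    define sd where "sd = sqrt (real d / real n) + real d / real n"
    assume model: "glatent_model d K G \<gamma>" and K: "2 \<le> K" and ln: "ln (real d) \<le> p0 * real n"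
      and "c1 * diag_norm d \<gamma> *
           (sqrt (ln (real d) / (real n * real (min_size K G)))
            + sqrt (real d / (real n * real (min_size K G) ^ 2))
            + real d / (real n * real (min_size K G)))
         + c2 * (Max {cov_of K L i i | i. i < K} + diag_norm d \<gamma>) * sqrt (ln (real d) / real n)
         \<le> Delta K (cov_of K L)"
    then have Delta: "c1 * \<Gamma> * (sqrt (ln (real d) / (real n * m)) + sqrt (real d / (real n * m ^ 2)) + real d / (real n * m))
        + c2 * \<sigma> * sl \<le> Delta K (cov_of K L)"
      by (simp add: m_def \<Gamma>_def \<sigma>_def sl_def)
    have "3 \<le> card (G 0)" "G 0 \<subseteq> {..<d}" using model K by (auto simp: glatent_model_def)
    then have d: "d > 1" using card_mono[of "{..<d}" "G 0"] by simp
    \<comment> \<open>Since \<open>d > 1\<close>, \<open>ln d\<close> is positive, whereas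
      \<open>n = 0\<close> would force it to be at most 0.\<close>
    have n: "n > 0" using ln d by (cases n) auto
    have \<Gamma>: "\<gamma> j \<le> \<Gamma>" if "j < d" for j using diag_norm_ge[OF that, of \<gamma>] by (simp add: \<Gamma>_def)
    have \<Gamma>0: "\<Gamma> \<ge> 0" using diag_norm_ge[of 0 d \<gamma>] d by (simp add: \<Gamma>_def)
    have \<sigma>: "cov_of K L i i + \<Gamma> \<le> \<sigma>" if "i < K" for i
      unfolding \<sigma>_def using that by (intro add_right_mono Max_ge) auto
    have "cov_of K L 0 0 \<ge> 0" by (simp add: cov_of_def sum_nonneg)
    \<comment> \<open>Latent variances are nonnegative; this lets the entrywise estimator error be
      charged to the \<open>\<sigma>\<close> term.\<close>
    then have \<sigma>\<Gamma>: "\<Gamma> \<le> \<sigma>" using \<sigma>[of 0] K by linarith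
    have sl: "sl \<ge> 0" and sd: "sd \<ge> 0" using d by (auto simp: sl_def sd_def)
    \<comment> \<open>This lets \<open>yT\<close>, which is of order \<open>sd\<close>, also absorb
      the estimator error of order \<open>sl\<close>.\<close>
    have slsd: "sl \<le> sd"
    proof -
      have "ln (real d) \<le> real d" using ln_le_minus_one[of "real d"] d by simp
      then have "sl \<le> sqrt (real d / real n)"
        unfolding sl_def by (intro real_sqrt_le_mono divide_right_mono) auto
      also have "\<dots> \<le> sd" by (simp add: sd_def)
      finally show ?thesis .
    qed
    let ?M = "glatent_space n K d"
    interpret prob_space ?M
      unfolding glatent_space_def by (rule prob_space_std_normal_PiM)
    obtain A1 where A1: "A1 \<in> events" "prob A1 \<ge> 1 - p2 / real d ^ 3"
      and gh: "\<And>w j. w \<in> A1 \<Longrightarrow> j < d \<Longrightarrow> \<bar>Gh n d (glatent_data n d K G L \<gamma> w) j - \<gamma> j\<bar> \<le> p1 * \<Gamma> * sl"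
      using assms model ln unfolding estimator_assumption_def \<Gamma>_def sl_def by meson
    obtain A2 where A2: "A2 \<in> events"
      "prob A2 \<ge> 1 - real (card (integer_net d)) * (2 * exp (- real n * min (160 * sd) ((160 * sd)\<^sup>2) / 8))"
      and net: "\<And>w k. w \<in> A2 \<Longrightarrow> k \<in> integer_net d \<Longrightarrow>
      \<bar>sample_quad n (K + d) w (noise_coeff K \<gamma> (\<lambda>a. real_of_int (k a)))
        - (\<Sum>r<K + d. (noise_coeff K \<gamma> (\<lambda>a. real_of_int (k a)) r)\<^sup>2)\<bar>
      \<le> (\<Sum>r<K + d. (noise_coeff K \<gamma> (\<lambda>a. real_of_int (k a)) r)\<^sup>2) * (160 * sd)"
      unfolding glatent_space_def
      by (rule uniform_sample_quad_event[OF finite_integer_net n, where t = "160 * sd" and R = "K + d"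
          and u = "\<lambda>k. noise_coeff K \<gamma> (\<lambda>a. real_of_int (k a))"]) (use sd in auto)
    have fin: "finite ({..<d} \<times> {..<d} \<times> {1, -1 :: real})" by simp
    obtain A3 where A3: "A3 \<in> events"
      "prob A3 \<ge> 1 - real (card ({..<d} \<times> {..<d} \<times> {1, -1 :: real})) * (2 * exp (- real n * min (k * sl) ((k * sl)\<^sup>2) / 8))"
      and pairs0: "\<And>w i. w \<in> A3 \<Longrightarrow> i \<in> {..<d} \<times> {..<d} \<times> {1, -1 :: real} \<Longrightarrow>
      \<bar>sample_quad n (K + d) w ((\<lambda>(a, b, s) r. data_coeff K G L \<gamma> a r + s * data_coeff K G L \<gamma> b r) i)
        - (\<Sum>r<K + d. ((\<lambda>(a, b, s) r. data_coeff K G L \<gamma> a r + s * data_coeff K G L \<gamma> b r) i r)\<^sup>2)\<bar>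
      \<le> (\<Sum>r<K + d. ((\<lambda>(a, b, s) r. data_coeff K G L \<gamma> a r + s * data_coeff K G L \<gamma> b r) i r)\<^sup>2) * (k * sl)"
      unfolding glatent_space_def
      by (rule uniform_sample_quad_event[OF fin n, where t = "k * sl" and R = "K + d"
          and u = "\<lambda>(a, b, s) r. data_coeff K G L \<gamma> a r + s * data_coeff K G L \<gamma> b r"]) (use k sl in auto)
    \<comment> \<open>The estimator is an arbitrary function of the data, so the certificate event
      itself may fail to be measurable; \<open>A\<close> is a measurable subset of it.\<close>
    define A where "A = A1 \<inter> (A2 \<inter> A3)"
    show "\<exists>A\<in>events. 1 - c3 / real d \<le> prob A \<and>
        (\<forall>w\<in>A. force_certificate K G
          (\<lambda>a b. (if a = b then Gh n d (glatent_data n d K G L \<gamma> w) a else 0)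
            - emp_cov n (glatent_data n d K G L \<gamma> w) a b))"
    proof (intro bexI[of _ A] conjI ballI)
      show "A \<in> events" using A1 A2 A3 by (auto simp: A_def)
      have "p2 / real d ^ 3 \<le> \<bar>p2\<bar> / real d ^ 3" by (intro divide_right_mono) auto
      also have "\<dots> \<le> \<bar>p2\<bar> / real d"
        using d by (intro divide_left_mono) (auto simp: power3_eq_cube mult_ge1_I)
      finally have "p2 / real d ^ 3 \<le> \<bar>p2\<bar> / real d" .
      moreover have "prob A2 \<ge> 1 - 1 / real d"
        using A2(2) integer_net_tail[OF _ n, of d] d unfolding sd_def by linarith
      moreover have "prob A3 \<ge> 1 - 4 / real d"
        using A3(2) pairs_tail[OF d n ln] unfolding sl_def k_def by linarith
      moreover have "prob A \<ge> prob A1 + prob A2 + prob A3 - 2"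
        using prob_Int_ge[of A1 "A2 \<inter> A3"] prob_Int_ge[of A2 A3] A1 A2 A3 by (simp add: A_def)
      moreover have "c3 / real d = 1 / real d + 4 / real d + \<bar>p2\<bar> / real d"
        by (simp add: c3_def add_divide_distrib)
      ultimately show "1 - c3 / real d \<le> prob A" using A1(2) by linarith
    next
      fix w assume w: "w \<in> A"
      show "force_certificate K G
          (\<lambda>a b. (if a = b then Gh n d (glatent_data n d K G L \<gamma> w) a else 0)
            - emp_cov n (glatent_data n d K G L \<gamma> w) a b)"
      proof (rule certificate_on_good_event[OF model _ _ _ \<Gamma> \<sigma>, where ?t1.0 = "160 * sd" and ?t2.0 = "k * sl"
            and \<delta> = "\<bar>p1\<bar> * \<Gamma> * sl" and yT = "c * \<Gamma> * sd"])
        show "0 < d" using d by simp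
        show "0 \<le> 160 * sd" using sd by simp
        show "0 \<le> k * sl" using k sl by simp
        show "\<bar>Gh n d (glatent_data n d K G L \<gamma> w) j - \<gamma> j\<bar> \<le> \<bar>p1\<bar> * \<Gamma> * sl" if "j < d" for j
        proof -
          have "p1 * \<Gamma> * sl \<le> \<bar>p1\<bar> * \<Gamma> * sl" using \<Gamma>0 sl by (intro mult_right_mono) auto
          then show ?thesis using gh[OF _ that, of w] w by (simp add: A_def)
        qed
        have "\<bar>p1\<bar> * \<Gamma> * sl \<le> \<bar>p1\<bar> * \<Gamma> * sd" using slsd \<Gamma>0 by (intro mult_left_mono) auto
        then show "4 * (\<Gamma> * (160 * sd)) + \<bar>p1\<bar> * \<Gamma> * sl \<le> c * \<Gamma> * sd"
          by (simp add: c_def distrib_right)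
        have m0: "m \<ge> 0" by (simp add: m_def)
        \<comment> \<open>Dividing by \<open>m\<close> turns \<open>sqrt (d / n)\<close> into
          \<open>sqrt (d / (n * m\<^sup>2))\<close> and \<open>d / n\<close> into
          \<open>d / (n * m)\<close>, the last two terms of the rate; adding the nonnegative
          logarithmic term then gives an upper bound.\<close>
        have "c * \<Gamma> * sd / m = c * \<Gamma> * (sqrt (real d / (real n * m ^ 2)) + real d / (real n * m))"
          using m0 by (simp add: sd_def real_sqrt_divide real_sqrt_mult add_divide_distrib distrib_left)
        also have "\<dots> \<le> c * \<Gamma> * (sqrt (ln (real d) / (real n * m)) + sqrt (real d / (real n * m ^ 2)) + real d / (real n * m))"
          using c \<Gamma>0 d m0 by (intro mult_left_mono) auto
        finally have "2 * (c * \<Gamma> * sd / m) \<le> c1 * \<Gamma> * (sqrt (ln (real d) / (real n * m)) + sqrt (real d / (real n * m ^ 2)) + real d / (real n * m))"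
          by (simp add: c1_def)
        moreover have "8 * (\<sigma> * (k * sl) + \<bar>p1\<bar> * \<Gamma> * sl) \<le> c2 * \<sigma> * sl"
        proof -
          have "\<bar>p1\<bar> * \<Gamma> * sl \<le> \<bar>p1\<bar> * \<sigma> * sl"
            using \<sigma>\<Gamma> sl by (intro mult_right_mono mult_left_mono) auto
          then show ?thesis by (simp add: c2_def algebra_simps)
        qed
        ultimately show "8 * (\<sigma> * (k * sl) + \<bar>p1\<bar> * \<Gamma> * sl) + 2 * (c * \<Gamma> * sd / real (min_size K G)) \<le> Delta K (cov_of K L)"
          using Delta unfolding m_def[symmetric] by linarith
      qed (use net pairs0[of w "(_, _, _)"] w in \<open>auto simp: A_def\<close>)
    qed
  qed
qed

end
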